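(* Let $F$ be a continuous MHR distribution, let $n\ge 2$ be an integer, and let $X_{n-1:n}$ denote the second-highest out of $n$ i.i.d. draws from $F$. Let $g_n(c)=c\left[1-\left(1-e^{-c(H_n-1)}\right)^n\right]$ and let $c_n=\operatorname{argmax}_{c\in[0,1]}g_n(c)$ be its (unique) maximizer in $[0,1]$. Then using the anonymous price $c_n\cdot\mathbb{E}[X_{n-1:n}]$ to sell an item to $n$ bidders with i.i.d. valuations from $F$ guarantees $$\frac{\mathrm{Myerson}(F,n)}{\mathrm{Price}(F,n,c_n\mathbb{E}[X_{n-1:n}])}\le \frac{1}{\max_{c\in[0,1]}g_n(c)}\left[1+\frac1e\,\frac{n-1}{n-H_n}\left(\frac{e-1}{e}\right)^{n-2}\right].$$
   Context: $F$ is the cdf of a continuous (absolutely continuous) probability distribution with pdf $f$, supported on an interval $D_F\subseteq[0,\infty)$. $F$ is MHR (monotone hazard rate) if $x\mapsto f(x)/(1-F(x))$ is nondecreasing on $D_F$; equivalently $\ln(1-F(x))$ is concave. For $n\ge 2$ bidders with i.i.d. valuations from $F$, let $X_{n:n}$ be the maximum of $n$ i.i.d. draws and $\phi(x)=x-\frac{1-F(x)}{f(x)}$ the virtual valuation. The optimal auction revenue is $\mathrm{Myerson}(F,n)=\mathbb{E}[\max\{0,\phi(X_{n:n})\}]$, and the expected revenue of offering the anonymous price $p\ge 0$ to all $n$ bidders is $\mathrm{Price}(F,n,p)=p\,(1-F(p)^n)$. $H_n=\sum_{i=1}^n 1/i$ is the $n$-th harmonic number. *)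

theory Defs
  imports "HOL-Probability.Probability"
begin

text \<open>
  A valuation distribution is given by its density \<open>f\<close>: the law is \<open>law f\<close>,
  and the library's \<open>cdf (law f)\<close> is the distribution function \<open>F\<close>.
\<close>

definition law :: "(real \<Rightarrow> real) \<Rightarrow> real measure" where
  "law f = density lborel (\<lambda>x. ennreal (f x))"

definition pdf_on :: "(real \<Rightarrow> real) \<Rightarrow> real set \<Rightarrow> bool" where
  "pdf_on f D \<longleftrightarrow>
     is_interval D \<and> D \<subseteq> {0..} \<and>
     f \<in> borel_measurable borel \<and> (\<forall>x. 0 \<le> f x) \<and> (\<forall>x. x \<notin> D \<longrightarrow> f x = 0) \<and>
     prob_space (law f)"

text \<open>
  Where \<open>F x = 1\<close> (at most the right end point of the support is relevant) the hazard rate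
  is \<open>\<infinity>\<close> by convention, so it imposes no condition there. Division by zero would instead
  give \<open>0\<close> and wrongly exclude, for instance, the uniform distribution on \<open>[0,1]\<close>.
\<close>

definition MHR :: "(real \<Rightarrow> real) \<Rightarrow> real set \<Rightarrow> bool" where
  "MHR f D \<longleftrightarrow>
     mono_on {x \<in> D. cdf (law f) x < 1} (\<lambda>x. f x / (1 - cdf (law f) x))"

text \<open>A profile of \<open>n\<close> i.i.d. valuations, indexed by \<open>{..<n}\<close>.\<close>

definition valuations :: "(real \<Rightarrow> real) \<Rightarrow> nat \<Rightarrow> (nat \<Rightarrow> real) measure" where
  "valuations f n = Pi\<^sub>M {..<n} (\<lambda>_. law f)"

text \<open>
  \<open>order_stat k n v\<close> is the \<open>k\<close>-th smallest of \<open>v 0, \<dots>, v (n - 1)\<close>, for \<open>1 \<le> k \<le> n\<close>; ties are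
  counted with multiplicity. So \<open>k = n\<close> is the maximum and \<open>k = n - 1\<close> the second highest.
\<close>

definition order_stat :: "nat \<Rightarrow> nat \<Rightarrow> (nat \<Rightarrow> real) \<Rightarrow> real" where
  "order_stat k n v = sort (map v [0..<n]) ! (k - 1)"

definition expected_order_stat :: "(real \<Rightarrow> real) \<Rightarrow> nat \<Rightarrow> nat \<Rightarrow> real" where
  "expected_order_stat f k n = (\<integral>v. order_stat k n v \<partial>valuations f n)"

text \<open>The points with \<open>f x = 0\<close>, where the quotient is meaningless, are a null set of \<open>law f\<close>.\<close>

definition virtual_valuation :: "(real \<Rightarrow> real) \<Rightarrow> real \<Rightarrow> real" where
  "virtual_valuation f x = x - (1 - cdf (law f) x) / f x"

definition Myerson :: "(real \<Rightarrow> real) \<Rightarrow> nat \<Rightarrow> real" where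
  "Myerson f n = (\<integral>v. max 0 (virtual_valuation f (order_stat n n v)) \<partial>valuations f n)"

definition Price :: "(real \<Rightarrow> real) \<Rightarrow> nat \<Rightarrow> real \<Rightarrow> real" where
  "Price f n p = p * (1 - cdf (law f) p ^ n)"

definition g :: "nat \<Rightarrow> real \<Rightarrow> real" where
  "g n c = c * (1 - (1 - exp (- c * (harm n - 1))) ^ n)"

definition c_opt :: "nat \<Rightarrow> real" where
  "c_opt n = (ARG_MAX (g n) c. c \<in> {0..1})"

end

theory Submission
  imports Defs "HOL-Real_Asymp.Real_Asymp"
begin

text \<open>
  Let \<open>\<Lambda> = - ln (1 - F)\<close>, a convex function, and let \<open>T(u)\<close> be the probability that at least two of
  \<open>n\<close> draws exceed the \<open>u\<close>-quantile, so that the expected second-highest value is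
  \<open>\<mu> = \<integral>\<^bsub>t \<ge> 0\<^esub> T(F t) dt\<close>.

  Price: choose \<open>m\<close> with \<open>\<Lambda> m = H\<^sub>n - 1\<close>. Replacing \<open>\<Lambda>\<close> by its tangent at \<open>m\<close> can only increase the
  integral, which then evaluates to \<open>m\<close>; hence \<open>\<mu> \<le> m\<close>, and \<open>\<Lambda>(c \<mu>) \<le> c \<Lambda> m = c (H\<^sub>n - 1)\<close> by convexity.
  So the price \<open>c \<mu>\<close> earns at least \<open>\<mu> g\<^sub>n(c)\<close>.

  Optimal revenue: with \<open>r\<close> the zero of the virtual valuation, it equals
  \<open>r (1 - F(r)\<^sup>n) + \<integral>\<^bsub>t \<ge> r\<^esub> T(F t) dt\<close>. On \<open>[0, r]\<close> the chord bound \<open>\<Lambda> t \<le> (t / r) \<Lambda> r\<close> bounds the missing part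
  of \<open>\<mu>\<close> from below by its value for an exponential distribution, and since \<open>\<Lambda> r \<le> 1\<close> what
  remains is an inequality in the single variable \<open>\<Lambda> r \<in> [0, 1]\<close>.

  Uniqueness of the maximizer: on \<open>c > 0\<close> the derivative of \<open>g\<^sub>n\<close> is a positive factor times a strictly
  decreasing function of \<open>c\<close>.
\<close>

subsection \<open>Analytic inequalities\<close>

text \<open>\<open>second_tail n u\<close> is the probability that at least two of \<open>n\<close> independent draws exceed the
  \<open>u\<close>-quantile.\<close>

definition second_tail :: "nat \<Rightarrow> real \<Rightarrow> real" where
  "second_tail n u = 1 - u ^ n - real n * u ^ (n - 1) * (1 - u)"

text \<open>An antiderivative of \<open>second_tail n u / (1 - u)\<close>: in the coordinate
  \<open>l = - ln (1 - u)\<close> it integrates \<open>second_tail\<close>. At \<open>u = 1\<close>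
  it equals \<open>harm n - 1\<close>, the source of that constant in \<open>g\<close>.\<close>

definition second_tail_prim :: "nat \<Rightarrow> real \<Rightarrow> real" where
  "second_tail_prim n u = (\<Sum>i=1..n. u ^ i / real i) - u ^ n"

lemma sum_geometric: "(1 - u) * (\<Sum>i<n. u ^ i) = 1 - (u::real) ^ n"
  by (simp add: one_diff_power_eq)

lemma power_split_two:
  fixes x :: "'a::comm_monoid_mult"
  assumes "n \<ge> 2"
  shows "x ^ (n - 1) = x * x ^ (n - 2)" "x ^ n = x * (x * x ^ (n - 2))"
proof -
  obtain k where "n = Suc (Suc k)"
    using assms by (metis Suc_le_D numeral_2_eq_2 Suc_le_mono)
  then show "x ^ (n - 1) = x * x ^ (n - 2)" "x ^ n = x * (x * x ^ (n - 2))"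
    by simp_all
qed

lemma DERIV_log_series:
  "((\<lambda>u. \<Sum>i=1..n. u ^ i / real i) has_real_derivative (\<Sum>i<n. u ^ i)) (at u)"
proof -
  have "((\<lambda>u. \<Sum>i=1..n. u ^ i / real i) has_real_derivative (\<Sum>i=1..n. u ^ (i - 1))) (at u)"
    by (auto intro!: derivative_eq_intros sum.cong)
  also have "(\<Sum>i=1..n. u ^ (i - 1)) = (\<Sum>i<n. u ^ i)"
    by (rule sum.reindex_bij_witness[of _ Suc "\<lambda>i. i - 1"]) auto
  finally show ?thesis .
qed

lemma DERIV_second_tail_prim:
  "(second_tail_prim n has_real_derivative (\<Sum>i<n. u ^ i) - real n * u ^ (n - 1)) (at u)"
  unfolding second_tail_prim_def[abs_def]
  by (rule DERIV_cong[OF DERIV_diff[OF DERIV_log_series DERIV_pow]]) simp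

text \<open>Chain rule along an exponential cdf of rate \<open>a\<close> started at
  \<open>x0\<close>. It evaluates the integral for both comparison distributions: the tangent one
  (\<open>x0\<close> is the zero of the tangent) and the chord one (\<open>x0 = 0\<close>).\<close>

lemma DERIV_second_tail_prim_exp:
  assumes "0 < a"
  shows "((\<lambda>y. second_tail_prim n (1 - exp (- (a * (y - x0)))) / a) has_real_derivative
      second_tail n (1 - exp (- (a * (y - x0))))) (at y)"
proof -
  let ?u = "\<lambda>y. 1 - exp (- (a * (y - x0)))"
  have "(?u has_real_derivative a * (1 - ?u y)) (at y)"
    by (auto intro!: derivative_eq_intros)
  from DERIV_cdivide[OF DERIV_chain2[OF DERIV_second_tail_prim this], of n a]
  have "((\<lambda>y. second_tail_prim n (?u y) / a) has_real_derivative
    ((1 - ?u y) * (\<Sum>i<n. ?u y ^ i) - real n * ?u y ^ (n - 1) * (1 - ?u y))) (at y)"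
    by (rule DERIV_cong) (use assms in \<open>simp add: field_simps\<close>)
  then show ?thesis
    unfolding sum_geometric second_tail_def .
qed

text \<open>The derivative is minus the density of the second highest of \<open>n\<close> uniform
  draws.\<close>

lemma second_tail_antimono:
  assumes "0 \<le> u" "u \<le> v" "v \<le> 1" "n \<ge> 2"
  shows "second_tail n v \<le> second_tail n u"
proof -
  have "(second_tail n has_real_derivative - (real n * (real n - 1) * x ^ (n - 2) * (1 - x))) (at x)" for x
  proof -
    have pow: "x ^ (n - 1) = x * x ^ (n - 2)" "x ^ n = x * (x * x ^ (n - 2))"
      using power_split_two[OF assms(4)] by auto
    show ?thesis
      unfolding second_tail_def[abs_def]
      by (rule derivative_eq_intros refl)+
        (use assms(4) in \<open>simp add: pow of_nat_diff numeral_2_eq_2 algebra_simps\<close>)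
  qed
  moreover have "- (real n * (real n - 1) * x ^ (n - 2) * (1 - x)) \<le> 0" if "u \<le> x" "x \<le> v" for x
    using that assms by simp
  ultimately show ?thesis
    by (intro DERIV_nonpos_imp_nonincreasing[OF assms(2)]) blast
qed

lemma second_tail_one: "n \<ge> 1 \<Longrightarrow> second_tail n 1 = 0"
  by (simp add: second_tail_def)

lemma second_tail_zero: "n \<ge> 2 \<Longrightarrow> second_tail n 0 = 1"
  by (simp add: second_tail_def power_0_left)

lemma second_tail_nonneg: "0 \<le> u \<Longrightarrow> u \<le> 1 \<Longrightarrow> n \<ge> 2 \<Longrightarrow> 0 \<le> second_tail n u"
  using second_tail_antimono[of u 1 n] by (simp add: second_tail_one)

lemma second_tail_le_one: "0 \<le> u \<Longrightarrow> u \<le> 1 \<Longrightarrow> second_tail n u \<le> 1"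
  by (simp add: second_tail_def mult.assoc) (smt (verit) mult_nonneg_nonneg of_nat_0_le_iff zero_le_power)

text \<open>Follows from the factorization into \<open>1 - u\<close> and the sum of
  \<open>u ^ i - u ^ (n - 1)\<close> over \<open>i < n\<close>: every summand is nonnegative and the
  one at \<open>i = 0\<close> is positive.\<close>

lemma second_tail_pos:
  assumes "0 \<le> u" "u < 1" "n \<ge> 2"
  shows "0 < second_tail n u"
proof -
  have "0 < 1 - u ^ (n - 1)"
    using assms by (simp add: power_less_one_iff)
  also have "\<dots> = (\<Sum>i\<in>{0}. u ^ i - u ^ (n - 1))"
    by simp
  also have "\<dots> \<le> (\<Sum>i<n. u ^ i - u ^ (n - 1))"
    using assms by (intro sum_mono2) (auto intro!: power_decreasing)
  finally have "0 < (1 - u) * (\<Sum>i<n. u ^ i - u ^ (n - 1))"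
    using assms by simp
  also have "\<dots> = second_tail n u"
    by (simp add: second_tail_def sum_subtractf right_diff_distrib sum_geometric) (simp add: algebra_simps)
  finally show ?thesis .
qed

text \<open>The left side is the value at \<open>n = 2\<close>, and passing from \<open>n\<close> to
  \<open>n + 1\<close> never decreases the right side.\<close>

lemma second_tail_prim_ge:
  assumes "0 \<le> u" "u \<le> 1" "n \<ge> 2"
  shows "u * (1 - u / 2) \<le> second_tail_prim n u"
  using assms(3)
proof (induction n rule: dec_induct)
  case base
  show ?case
    by (simp add: second_tail_prim_def numeral_2_eq_2 power2_eq_square field_simps)
next
  case (step n)
  have "u ^ n * (1 - u * (n / (n + 1))) \<ge> 0"
    using assms by (intro mult_nonneg_nonneg) (auto simp: divide_le_eq intro: order_trans[OF mult_left_le_one_le])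
  also have "u ^ n * (1 - u * (n / (n + 1))) = second_tail_prim (Suc n) u - second_tail_prim n u"
    by (simp add: second_tail_prim_def divide_simps) (simp add: algebra_simps)
  finally show ?case
    using step.IH by simp
qed

section \<open>Logarithm estimates and the one-variable ratio inequality\<close>

lemma DERIV_power_over_linear:
  fixes x N :: real
  assumes "x < 1" "N \<noteq> 0"
  shows "((\<lambda>x. x ^ m / (N * (1 - x))) has_real_derivative
    real m * x ^ (m - 1) / (N * (1 - x)) + x ^ m / (N * (1 - x)\<^sup>2)) (at x)"
  by (rule derivative_eq_intros refl)+
    (use assms in \<open>simp_all add: divide_simps power2_eq_square, simp add: algebra_simps\<close>)

text \<open>The left side is the tail of the logarithm series, with derivative
  \<open>x ^ n / (1 - x)\<close>. The derivative of the right side contains this term plus a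
  nonnegative one, and both sides vanish at 0.\<close>

lemma neg_ln_one_minus_le:
  assumes "0 \<le> u" "u < 1"
  shows "- ln (1 - u) - (\<Sum>i=1..n. u ^ i / real i) \<le> u ^ (n + 1) / (real (n + 1) * (1 - u))"
proof -
  let ?k = "\<lambda>u. u ^ (n + 1) / (real (n + 1) * (1 - u)) + ln (1 - u) + (\<Sum>i=1..n. u ^ i / real i)"
  have "?k 0 \<le> ?k u"
  proof (rule DERIV_nonneg_imp_nondecreasing[OF assms(1)])
    fix x assume x: "0 \<le> x" "x \<le> u"
    with assms have x1: "x < 1" by simp
    have geo: "(\<Sum>i<n. x ^ i) = (1 - x ^ n) / (1 - x)"
      using x1 sum_geometric[of x n] by (simp add: field_simps)
    have "((\<lambda>x. x ^ (n + 1) / (real (n + 1) * (1 - x))) has_real_derivative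
        x ^ n / (1 - x) + x ^ (n + 1) / (real (n + 1) * (1 - x)\<^sup>2)) (at x)"
      using DERIV_power_over_linear[OF x1, of "real (n + 1)" "n + 1"] by (simp add: of_nat_0_neq del: of_nat_add)
    moreover have "((\<lambda>x. ln (1 - x)) has_real_derivative - (1 / (1 - x))) (at x)"
      using x1 by (auto intro!: derivative_eq_intros)
    ultimately have "(?k has_real_derivative x ^ n / (1 - x) + x ^ (n + 1) / (real (n + 1) * (1 - x)\<^sup>2)
        + - (1 / (1 - x)) + (1 - x ^ n) / (1 - x)) (at x)"
      using DERIV_log_series[THEN DERIV_cong[OF _ geo]] by (intro DERIV_add)
    then have "(?k has_real_derivative x ^ (n + 1) / (real (n + 1) * (1 - x)\<^sup>2)) (at x)"
      by (rule DERIV_cong) (simp add: diff_divide_distrib)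
    moreover have "0 \<le> x ^ (n + 1) / (real (n + 1) * (1 - x)\<^sup>2)"
      using x by simp
    ultimately show "\<exists>y. (?k has_real_derivative y) (at x) \<and> 0 \<le> y" by blast
  qed
  then show ?thesis by (simp add: sum.neutral power_0_left)
qed

lemma exp_one_bounds: "(2.71::real) < exp 1" "exp 1 < (2.72::real)"
  using e_approx_32 e_less_272 by (auto simp: abs_if split: if_splits)

text \<open>\<open>u * gap_bound n u\<close> bounds \<open>l * (1 - u ^ n) - second_tail_prim n u\<close> for \<open>l = - ln (1 - u)\<close>.\<close>

definition gap_bound :: "nat \<Rightarrow> real \<Rightarrow> real" where
  "gap_bound n u = (1 + ln (1 - u)) * u ^ (n - 1) + u ^ n / (real (n + 1) * (1 - u))"

text \<open>With \<open>w = x / (1 - x)\<close>, the derivative is \<open>x ^ (n - 2)\<close> times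
  \<open>(n - 1) * (1 + ln (1 - x)) + w * (w - 1) / (n + 1)\<close>. The cap on \<open>v\<close> is
  exactly where \<open>1 + ln (1 - x)\<close> stays nonnegative. The other term is negative only for
  \<open>w < 1\<close>, that is \<open>x < 1 / 2\<close>, and there it is at least -1/4 while the
  first is at least 1/4.\<close>

lemma gap_bound_mono:
  assumes n: "n \<ge> 2" and u: "0 \<le> u" "u \<le> v" and v: "v \<le> 1 - exp (- 1)"
  shows "gap_bound n u \<le> gap_bound n v"
proof (rule DERIV_nonneg_imp_nondecreasing[OF u(2)])
  fix x assume x: "u \<le> x" "x \<le> v"
  define w where "w = x / (1 - x)"
  have x1: "x < 1" "0 \<le> x" "exp (- 1) \<le> 1 - x"
    using x u v by (smt (verit) exp_gt_zero)+
  have lnx: "0 \<le> 1 + ln (1 - x)"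
    using x1 ln_ge_iff[of "1 - x" "- 1"] by simp
  have xw: "x = w * (1 - x)" "x / (1 - x) = w"
    using x1 by (simp_all add: w_def)
  have pow: "x ^ (n - 1) = x * x ^ (n - 2)" "x ^ n = x * (x * x ^ (n - 2))"
    using power_split_two[OF n] by auto
  have "((\<lambda>x. (1 + ln (1 - x)) * x ^ (n - 1)) has_real_derivative
      - (1 / (1 - x)) * x ^ (n - 1) + (1 + ln (1 - x)) * ((real n - 1) * x ^ (n - 2))) (at x)"
    using x1 n by (auto intro!: derivative_eq_intros simp: of_nat_diff numeral_2_eq_2)
  from DERIV_add[OF this DERIV_power_over_linear[OF x1(1), of "real (n + 1)" n]]
  have "(gap_bound n has_real_derivative
      - (1 / (1 - x)) * x ^ (n - 1) + (1 + ln (1 - x)) * ((real n - 1) * x ^ (n - 2))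
      + (real n * x ^ (n - 1) / (real (n + 1) * (1 - x)) + x ^ n / (real (n + 1) * (1 - x)\<^sup>2))) (at x)"
    by (simp add: gap_bound_def[abs_def])
  also have "- (1 / (1 - x)) * x ^ (n - 1) + (1 + ln (1 - x)) * ((real n - 1) * x ^ (n - 2))
      + (real n * x ^ (n - 1) / (real (n + 1) * (1 - x)) + x ^ n / (real (n + 1) * (1 - x)\<^sup>2))
    = - (x / (1 - x)) * x ^ (n - 2) + (1 + ln (1 - x)) * ((real n - 1) * x ^ (n - 2))
      + (real n * (x / (1 - x)) * x ^ (n - 2) / (real n + 1) + (x / (1 - x))\<^sup>2 * x ^ (n - 2) / (real n + 1))"
    unfolding pow by (simp add: power2_eq_square mult.assoc mult.commute add.commute)
  also have "\<dots> = x ^ (n - 2) * ((real n - 1) * (1 + ln (1 - x)) + w * (w - 1) / (real n + 1))"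
    unfolding xw(2) by (simp add: divide_simps power2_eq_square) (simp add: algebra_simps)
  finally have "(gap_bound n has_real_derivative
      x ^ (n - 2) * ((real n - 1) * (1 + ln (1 - x)) + w * (w - 1) / (real n + 1))) (at x)" .
  moreover have "0 \<le> (real n - 1) * (1 + ln (1 - x)) + w * (w - 1) / (real n + 1)"
  proof (cases "w \<ge> 1")
    case True
    moreover have "0 \<le> (real n - 1) * (1 + ln (1 - x))"
      using n lnx by (intro mult_nonneg_nonneg[of "real n - 1"]) auto
    ultimately show ?thesis
      by simp
  next
    case False
    then have "1 - x > 1 / 2"
      using x1 by (simp add: w_def field_simps)
    then have "ln (1 - x) > ln (1 / 2)" by simp
    then have "1 + ln (1 - x) \<ge> 1 / 4"
      using ln2_le_25_over_36 by (simp add: ln_div)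
    then have "(real n - 1) * (1 + ln (1 - x)) \<ge> 1 * (1 / 4)"
      using n by (intro mult_mono) auto
    moreover have "w * (w - 1) \<ge> - (1 / 4)"
      using zero_le_power2[of "w - 1 / 2"] by (simp add: power2_eq_square algebra_simps)
    then have "w * (w - 1) / (real n + 1) \<ge> - (1 / 4)"
      by (simp add: field_simps)
    ultimately show ?thesis by simp
  qed
  ultimately show "\<exists>y. (gap_bound n has_real_derivative y) (at x) \<and> 0 \<le> y"
    using x1 by (meson mult_nonneg_nonneg zero_le_power)
qed

lemma harm_bounds:
  assumes "n \<ge> 2"
  shows "1 < (harm n :: real)" "harm n < real n"
  using assms
proof (induction n rule: dec_induct)
  case base
  { case 1 show ?case by (simp add: harm_def numeral_2_eq_2) }
  { case 2 show ?case by (simp add: harm_def numeral_2_eq_2) }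
next
  case (step n)
  have "0 < inverse (1 + real n)" by simp
  then show "1 < (harm (Suc n) :: real)"
    using step.IH(1) by (simp add: harm_Suc del: inverse_positive_iff_positive)
  have "inverse (1 + real n) < 1"
    using step.hyps by (simp add: inverse_less_1_iff)
  then show "harm (Suc n) < real (Suc n)"
    using step.IH(2) by (simp add: harm_Suc)
qed

text \<open>The bracket of the theorem; it bounds the optimal revenue relative to the expected
  second-highest value.\<close>

definition ratio_bound :: "nat \<Rightarrow> real" where
  "ratio_bound n = 1 + 1 / exp 1 * ((real n - 1) / (real n - harm n)) * ((exp 1 - 1) / exp 1) ^ (n - 2)"

lemma ratio_bound_ge_one: "n \<ge> 2 \<Longrightarrow> 1 \<le> ratio_bound n"
  using harm_bounds[of n] by (simp add: ratio_bound_def)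

text \<open>The constant on the left is \<open>exp 1 ^ 2 * v ^ 2 / (1 - v / 2)\<close> at
  \<open>v = 1 - exp (- 1)\<close>, the factor that \<open>ratio_bound_ge\<close> has to
  absorb.\<close>

lemma ratio_constant_ge:
  assumes n: "n \<ge> 2"
  shows "2 * (exp 1 - 1)\<^sup>2 * exp 1 / (exp 1 + 1) \<le> (real n - 1) / (real n - harm n) * (real n + 1)"
proof -
  have "2 * (exp 1 - 1)\<^sup>2 * exp 1 / (exp 1 + 1) \<le> (2 * (1.72)\<^sup>2 * 2.72 / 3.71 :: real)"
    using exp_one_bounds by (intro frac_le mult_mono power_mono) auto
  also have "\<dots> \<le> 4.5" by (simp add: power2_eq_square)
  also have "4.5 \<le> (real n - 1) / (real n - harm n) * (real n + 1)"
  proof -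
    \<comment> \<open>Bounding the quotient below by 1 leaves \<open>n + 1\<close>, which exceeds
      4.5 only from \<open>n = 4\<close> on; for 2 and 3 the values are 6 and 48/7.\<close>
    consider "n = 2" | "n = 3" | "n \<ge> 4" using n by linarith
    then show ?thesis
    proof cases
      case 3
      have "(real n - 1) / (real n - harm n) \<ge> 1"
        using harm_bounds[OF n] by (simp add: less_imp_le)
      with 3 have "1 * 5 \<le> (real n - 1) / (real n - harm n) * (real n + 1)"
        by (intro mult_mono) auto
      then show ?thesis by linarith
    qed (simp_all add: harm_def eval_nat_numeral)
  qed
  finally show ?thesis .
qed

text \<open>The quotient of \<open>l * (1 - (1 - exp (- l)) ^ n)\<close> and \<open>second_tail_prim n (1 - exp (- l))\<close> is the ratio of the
  optimal revenue to the expected second-highest value for the exponential distribution truncated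
  (with an atom) where its cumulative hazard is \<open>l\<close>, which is the extremal case.\<close>

lemma ratio_bound_ge:
  assumes n: "n \<ge> 2" and l: "0 \<le> l" "l \<le> 1"
  shows "l * (1 - (1 - exp (- l)) ^ n) \<le> ratio_bound n * second_tail_prim n (1 - exp (- l))"
proof -
  define u v K where "u = 1 - exp (- l)" and "v = 1 - exp (- 1 :: real)"
    and "K = (real n - 1) / (real n - harm n)"
  have u: "0 \<le> u" "u \<le> v" "u < 1" "v < 1" "0 \<le> v"
    using l by (auto simp: u_def v_def)
  have l_u: "l = - ln (1 - u)" by (simp add: u_def)
  have v_eq: "v = (exp 1 - 1) / exp 1" "1 - v / 2 = (exp 1 + 1) / (2 * exp 1)"
    by (simp_all add: v_def exp_minus field_simps)
  have pow: "u * u ^ (n - 1) = u ^ n" "v * v ^ (n - 1) = v ^ n" "v ^ n = v\<^sup>2 * v ^ (n - 2)"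
    using power_split_two[OF n, of u] power_split_two[OF n, of v] by (simp_all add: power2_eq_square mult.assoc)
  have "l * (1 - u ^ n) - second_tail_prim n u = (1 - l) * u ^ n + (l - (\<Sum>i=1..n. u ^ i / real i))"
    by (simp add: second_tail_prim_def algebra_simps)
  also have "\<dots> \<le> (1 - l) * u ^ n + u ^ (n + 1) / (real (n + 1) * (1 - u))"
    using neg_ln_one_minus_le[OF u(1) u(3), of n] by (simp add: l_u)
  also have "\<dots> = u * gap_bound n u"
    using pow(1) by (simp add: gap_bound_def l_u ring_distribs algebra_simps)
  also have "\<dots> \<le> u * gap_bound n v"
    using gap_bound_mono[OF n u(1,2)] u by (intro mult_left_mono) (auto simp: v_def)
  \<comment> \<open>At \<open>v\<close> the factor \<open>1 + ln (1 - v)\<close> vanishes and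
    \<open>1 / (1 - v) = exp 1\<close>, so only the second summand of \<open>gap_bound\<close>
    survives.\<close>
  also have "gap_bound n v = exp 1 * v ^ n / (real n + 1)"
    by (simp add: gap_bound_def v_def) (simp add: exp_minus field_simps)
  \<comment> \<open>The factor \<open>u * (1 - v / 2)\<close> is split off because
    \<open>second_tail_prim_ge\<close> places it below \<open>second_tail_prim n u\<close>.\<close>
  also have "u * \<dots> = (2 * (exp 1 - 1)\<^sup>2 * exp 1 / (exp 1 + 1)) / (real n + 1) *
      (1 / exp 1 * v ^ (n - 2)) * (u * (1 - v / 2))"
  proof -
    have "exp 1 * v\<^sup>2 = 2 * (exp 1 - 1)\<^sup>2 * exp 1 / (exp 1 + 1) * (1 / exp 1) * (1 - v / 2)"
      unfolding v_eq(2) v_eq(1) using add_pos_pos[OF exp_gt_zero[of "1::real"] zero_less_one]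
      by (simp add: divide_simps power2_eq_square)
    then show ?thesis
      unfolding pow(3) by (simp add: mult.assoc[symmetric])
  qed
  also have "\<dots> \<le> K * (1 / exp 1 * v ^ (n - 2)) * (u * (1 - v / 2))"
  proof -
    have "C / (real n + 1) \<le> K" if "C \<le> K * (real n + 1)" for C
      using that by (simp add: divide_le_eq)
    from this[of "2 * (exp 1 - 1)\<^sup>2 * exp 1 / (exp 1 + 1)"] show ?thesis
      using ratio_constant_ge[OF n] u by (intro mult_right_mono) (simp_all add: K_def)
  qed
  also have "\<dots> \<le> K * (1 / exp 1 * v ^ (n - 2)) * second_tail_prim n u"
  proof (rule mult_left_mono)
    have "u * (1 - v / 2) \<le> u * (1 - u / 2)"
      using u by (intro mult_left_mono) auto
    also have "\<dots> \<le> second_tail_prim n u"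
      using second_tail_prim_ge[OF u(1) _ n] u by simp
    finally show "u * (1 - v / 2) \<le> second_tail_prim n u" .
    show "0 \<le> K * (1 / exp 1 * v ^ (n - 2))"
      using u n harm_bounds[OF n] by (simp add: K_def)
  qed
  finally have "l * (1 - u ^ n) \<le> (1 + 1 / exp 1 * K * v ^ (n - 2)) * second_tail_prim n u"
    by (simp add: algebra_simps)
  then show ?thesis
    by (simp add: ratio_bound_def K_def v_eq(1) u_def)
qed

section \<open>The unique maximizer of \<open>g n\<close>\<close>

lemma g_deriv:
  assumes "n \<ge> 1"
  defines "u \<equiv> \<lambda>c::real. 1 - exp (- c * (harm n - 1))"
  shows "(g n has_real_derivative (1 - u c) * ((\<Sum>i<n. u c ^ i) - c * (harm n - 1) * real n * u c ^ (n - 1))) (at c)"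
proof -
  have "(u has_real_derivative (harm n - 1) * (1 - u c)) (at c)"
    unfolding u_def by (auto intro!: derivative_eq_intros simp: algebra_simps)
  then have "((\<lambda>c. c * (1 - u c ^ n)) has_real_derivative
      (1 - u c ^ n) - c * (harm n - 1) * real n * u c ^ (n - 1) * (1 - u c)) (at c)"
    by (auto intro!: derivative_eq_intros)
  moreover have "g n = (\<lambda>c. c * (1 - u c ^ n))"
    by (simp add: fun_eq_iff g_def u_def)
  ultimately show ?thesis
    by (simp add: right_diff_distrib sum_geometric) (simp add: algebra_simps)
qed

lemma g_pos:
  assumes "n \<ge> 2" "0 < c"
  shows "0 < g n c"
proof -
  have "exp (- c * (harm n - 1)) \<le> 1"
    using assms harm_bounds(1)[of n] by simp
  then have "(1 - exp (- c * (harm n - 1))) ^ n < 1"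
    using assms by (subst power_less_one_iff) auto
  then show ?thesis
    using assms by (simp add: g_def)
qed

text \<open>Taking \<open>u c ^ (n - 1)\<close> out of the derivative leaves \<open>b\<close>: a sum
  of powers of \<open>1 / u\<close>, nonincreasing in \<open>c\<close>, minus a strictly increasing
  linear term. Hence \<open>b\<close> is positive before its zero \<open>z\<close>.\<close>

lemma g_strict_before_critical:
  assumes n: "n \<ge> 2" and c: "0 < c" "c < z" and z: "(g n has_real_derivative 0) (at z)"
  shows "g n c < g n z"
proof (rule DERIV_pos_imp_increasing_open[OF c(2)])
  define u where "u = (\<lambda>c::real. 1 - exp (- c * (harm n - 1)))"
  define b where "b = (\<lambda>c. (\<Sum>i<n. (1 / u c) ^ (n - 1 - i)) - c * (harm n - 1) * real n)"
  have a: "0 < harm n - (1::real)" using harm_bounds[OF n] by simp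
  have u: "0 < u c" "u c < 1" if "0 < c" for c
    using that a by (auto simp: u_def)
  have deriv: "(g n has_real_derivative (1 - u c) * (u c ^ (n - 1) * b c)) (at c)" if "0 < c" for c
  proof -
    have "u c ^ (n - 1) * (1 / u c) ^ (n - 1 - i) = u c ^ i" if "i < n" for i
    proof -
      have "u c ^ (n - 1) = u c ^ i * u c ^ (n - 1 - i)"
        using that by (simp flip: power_add)
      then show ?thesis using u[OF \<open>0 < c\<close>] by (simp add: power_divide)
    qed
    then have "u c ^ (n - 1) * b c = (\<Sum>i<n. u c ^ i) - c * (harm n - 1) * real n * u c ^ (n - 1)"
      by (simp add: b_def right_diff_distrib sum_distrib_left)
    then show ?thesis
      using g_deriv[of n c] n by (simp add: u_def)
  qed
  have "b z = 0"
    using DERIV_unique[OF deriv z] u[of z] c by simp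
  fix x assume x: "c < x" "x < z"
  have "u x \<le> u z"
    using x a by (simp add: u_def)
  then have "1 / u z \<le> 1 / u x"
    using u[of x] u[of z] x c by (intro divide_left_mono) auto
  then have "(\<Sum>i<n. (1 / u z) ^ (n - 1 - i)) \<le> (\<Sum>i<n. (1 / u x) ^ (n - 1 - i))"
    using u[of z] x c by (intro sum_mono power_mono) auto
  moreover have "x * (harm n - 1) * real n < z * (harm n - 1) * real n"
    using x a n by simp
  ultimately have "0 < b x"
    using \<open>b z = 0\<close> by (simp add: b_def)
  then show "\<exists>y. (g n has_real_derivative y) (at x) \<and> 0 < y"
    using deriv[of x] u[of x] x c by (intro exI[of _ "(1 - u x) * (u x ^ (n - 1) * b x)"]) auto
next
  show "continuous_on {c..z} (g n)"
    unfolding g_def[abs_def] by (intro continuous_intros)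
qed

text \<open>Between two maximizers, Rolle's theorem gives a critical point, whose value is strictly
  larger than at the left one. The left one is positive because \<open>g n\<close> is 0 at 0 and
  positive at 1.\<close>

lemma unique_maximizer_g:
  assumes n: "n \<ge> 2"
  shows "\<exists>!c. is_arg_max (g n) (\<lambda>c. c \<in> {0..1}) c"
proof -
  have cont: "continuous_on A (g n)" for A
    unfolding g_def[abs_def] by (intro continuous_intros)
  obtain c where c: "c \<in> {0..1}" "\<And>x. x \<in> {0..1} \<Longrightarrow> g n x \<le> g n c"
    using continuous_attains_sup[OF compact_Icc _ cont, of 0 1] by auto
  have max: "is_arg_max (g n) (\<lambda>c. c \<in> {0..1}) x \<longleftrightarrow> x \<in> {0..1} \<and> g n x = g n c" for x
    using c by (force simp: is_arg_max_linorder)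
  have False if xy: "x \<in> {0..1}" "y \<in> {0..1}" "x < y" and eq: "g n x = g n c" "g n y = g n c" for x y
  proof -
    have "g n x > 0"
      using c(2)[of 1] g_pos[OF n, of 1] eq by simp
    then have "0 < x"
      using xy by (cases "x = 0") (auto simp: g_def)
    obtain z where z: "x < z" "z < y" "(g n has_real_derivative 0) (at z)"
    proof -
      have "g n differentiable (at z)" for z
        using g_deriv[of n z] n real_differentiable_def by fastforce
      then show ?thesis
        using Rolle[OF \<open>x < y\<close>, of "g n"] eq cont that by auto
    qed
    have "g n x < g n z"
      using g_strict_before_critical[OF n \<open>0 < x\<close> z(1,3)] .
    then show False
      using c(2)[of z] z xy eq by simp
  qed
  then show ?thesis
    using c unfolding max by (metis linorder_neqE_linordered_idom)
qed

lemma c_opt: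
  assumes "n \<ge> 2"
  shows "c_opt n \<in> {0<..1}" "g n (c_opt n) = (SUP c\<in>{0..1}. g n c)" "0 < g n (c_opt n)"
proof -
  have "is_arg_max (g n) (\<lambda>c. c \<in> {0..1}) (c_opt n)"
    using unique_maximizer_g[OF assms] unfolding c_opt_def arg_max_def by (metis someI_ex)
  then have c: "c_opt n \<in> {0..1}" "\<And>x. x \<in> {0..1} \<Longrightarrow> g n x \<le> g n (c_opt n)"
    by (auto simp: is_arg_max_linorder)
  show "0 < g n (c_opt n)"
    using c(2)[of 1] g_pos[OF assms, of 1] by simp
  then show "c_opt n \<in> {0<..1}"
    using c(1) by (cases "c_opt n = 0") (auto simp: g_def)
  show "g n (c_opt n) = (SUP c\<in>{0..1}. g n c)"
    using c by (intro cSup_eq_maximum[symmetric]) auto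
qed

subsection \<open>Order statistics of independent draws\<close>

text \<open>In a sorted list the entries below \<open>y\<close> form a prefix; the zero-based index
  \<open>k\<close> lies in it iff its length exceeds \<open>k\<close>.\<close>

lemma sorted_nth_le_iff:
  fixes xs :: "'a::linorder list"
  assumes "sorted xs" "k < length xs"
  shows "xs ! k \<le> y \<longleftrightarrow> k < length (filter (\<lambda>x. x \<le> y) xs)"
  using assms
proof (induction xs arbitrary: k)
  case (Cons x xs)
  show ?case
  proof (cases "x \<le> y")
    case True
    then show ?thesis using Cons by (cases k) auto
  next
    case False
    then have "\<not> z \<le> y" if "z \<in> set (x # xs)" for z
      using that Cons.prems(1) by auto
    then have "filter (\<lambda>x. x \<le> y) (x # xs) = []" "\<not> (x # xs) ! k \<le> y"
      using Cons.prems(2) nth_mem[of k "x # xs"] by (auto simp: filter_empty_conv simp del: filter.simps)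
    then show ?thesis by simp
  qed
qed simp

lemma order_stat_le_iff:
  assumes "1 \<le> k" "k \<le> n"
  shows "order_stat k n v \<le> y \<longleftrightarrow> k \<le> card {i. i < n \<and> v i \<le> y}"
proof -
  let ?xs = "map v [0..<n]"
  have "length (filter (\<lambda>x. x \<le> y) (sort ?xs)) = length (filter (\<lambda>x. x \<le> y) ?xs)"
    by (metis mset_filter mset_sort size_mset)
  also have "\<dots> = card {i. i < n \<and> v i \<le> y}"
    by (auto simp: length_filter_conv_card intro!: arg_cong[of _ _ card])
  finally show ?thesis
    using sorted_nth_le_iff[of "sort ?xs" "k - 1" y] assms by (auto simp: order_stat_def)
qed

lemma maximum_le_iff:
  assumes "1 \<le> n"
  shows "order_stat n n v \<le> y \<longleftrightarrow> (\<forall>i<n. v i \<le> y)"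
proof -
  have "n \<le> card {i. i < n \<and> v i \<le> y} \<longleftrightarrow> {i. i < n \<and> v i \<le> y} = {..<n}"
  proof
    assume "n \<le> card {i. i < n \<and> v i \<le> y}"
    then show "{i. i < n \<and> v i \<le> y} = {..<n}"
      by (intro card_seteq) auto
  qed simp
  then show ?thesis
    using order_stat_le_iff[of n n v y] assms by auto
qed

text \<open>At most one draw exceeds \<open>y\<close>. Naming the draw that does turns the event
  into a disjoint union of boxes, whose probabilities are products.\<close>

lemma second_highest_le_iff:
  assumes "2 \<le> n"
  shows "order_stat (n - 1) n v \<le> y \<longleftrightarrow>
    (\<forall>i<n. v i \<le> y) \<or> (\<exists>j<n. \<forall>i<n. if i = j then y < v i else v i \<le> y)"
proof -
  let ?P = "{i. i < n \<and> v i \<le> y}" and ?N = "{i. i < n \<and> y < v i}"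
  have "card ?P + card ?N = card (?P \<union> ?N)"
    by (subst card_Un_disjoint) auto
  also have "?P \<union> ?N = {..<n}" by auto
  finally have "n - 1 \<le> card ?P \<longleftrightarrow> card ?N \<le> Suc 0" using assms by auto
  also have "\<dots> \<longleftrightarrow> (\<forall>a\<in>?N. \<forall>b\<in>?N. a = b)"
    by (rule card_le_Suc0_iff_eq) simp
  also have "\<dots> \<longleftrightarrow> (\<forall>i<n. v i \<le> y) \<or> (\<exists>j<n. \<forall>i<n. if i = j then y < v i else v i \<le> y)"
  proof (cases "?N = {}")
    case True
    then have "\<forall>i<n. v i \<le> y" by (auto simp: not_le[symmetric])
    with True show ?thesis by fastforce
  next
    case False
    then obtain j where j: "j < n" "y < v j" by auto
    then have "(\<forall>a\<in>?N. \<forall>b\<in>?N. a = b) \<longleftrightarrow> (\<forall>i<n. y < v i \<longrightarrow> i = j)"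
      by blast
    also have "\<dots> \<longleftrightarrow> (\<exists>j<n. \<forall>i<n. if i = j then y < v i else v i \<le> y)"
      using j by (metis not_le)
    also have "\<dots> \<longleftrightarrow> (\<forall>i<n. v i \<le> y) \<or> \<dots>"
      using j by (meson not_le)
    finally show ?thesis .
  qed
  finally show ?thesis
    using order_stat_le_iff[of "n - 1" n v y] assms by auto
qed

text \<open>Layer-cake formula: \<open>ennreal\<close> truncates \<open>X w - r\<close> at 0, so it
  is the length of \<open>{r..<X w}\<close>, and the two integrals are exchanged.\<close>

lemma (in sigma_finite_measure) nn_integral_tail:
  fixes X :: "'a \<Rightarrow> real"
  assumes [measurable]: "X \<in> borel_measurable M"
  shows "(\<integral>\<^sup>+w. ennreal (X w - r) \<partial>M) =
    (\<integral>\<^sup>+t. emeasure M {w \<in> space M. t < X w} * indicator {r..} t \<partial>lborel)"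
proof -
  interpret pair_sigma_finite M lborel
    by (simp add: pair_sigma_finite_def sigma_finite_measure_axioms sigma_finite_lborel)
  have "(\<integral>\<^sup>+w. ennreal (X w - r) \<partial>M) = (\<integral>\<^sup>+w. \<integral>\<^sup>+t. indicator {r..<X w} t \<partial>lborel \<partial>M)"
  proof (rule nn_integral_cong)
    fix w
    show "ennreal (X w - r) = (\<integral>\<^sup>+t. indicator {r..<X w} t \<partial>lborel)"
      by (cases "r \<le> X w") (auto simp: ennreal_neg)
  qed
  also have "\<dots> = (\<integral>\<^sup>+w. \<integral>\<^sup>+t. indicator {t. r \<le> t \<and> t < X w} t \<partial>lborel \<partial>M)"
    by (simp add: atLeastLessThan_def atLeast_def lessThan_def Int_def)
  also have "\<dots> = (\<integral>\<^sup>+t. \<integral>\<^sup>+w. indicator {t. r \<le> t \<and> t < X w} t \<partial>M \<partial>lborel)"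
    by (rule Fubini'[symmetric]) (simp add: measurable_split_conv)
  also have "\<dots> = (\<integral>\<^sup>+t. emeasure M {w \<in> space M. t < X w} * indicator {r..} t \<partial>lborel)"
  proof (rule nn_integral_cong)
    fix t
    have "(\<integral>\<^sup>+w. indicator {t. r \<le> t \<and> t < X w} t \<partial>M) =
        (\<integral>\<^sup>+w. indicator {r..} t * indicator {w \<in> space M. t < X w} w \<partial>M)"
      by (intro nn_integral_cong) (auto split: split_indicator)
    then show "(\<integral>\<^sup>+w. indicator {t. r \<le> t \<and> t < X w} t \<partial>M) =
        emeasure M {w \<in> space M. t < X w} * indicator {r..} t"
      by (simp add: nn_integral_cmult mult.commute)
  qed
  finally show ?thesis .
qed

section \<open>A single valuation and the probability integral transform\<close>

locale valuation_density =
  fixes f :: "real \<Rightarrow> real" and D :: "real set"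
  assumes pdf: "pdf_on f D"
begin

abbreviation F :: "real \<Rightarrow> real" where "F \<equiv> cdf (law f)"

lemma f_measurable [measurable]: "f \<in> borel_measurable borel"
  and f_nonneg: "0 \<le> f x"
  and f_outside: "x \<notin> D \<Longrightarrow> f x = 0"
  and D_interval: "is_interval D"
  and D_nonneg: "D \<subseteq> {0..}"
  using pdf by (auto simp: pdf_on_def)

sublocale real_distribution "law f"
proof -
  interpret prob_space "law f" using pdf by (simp add: pdf_on_def)
  show "real_distribution (law f)"
    by standard (simp add: law_def)
qed

lemma emeasure_law: "A \<in> sets borel \<Longrightarrow> emeasure (law f) A = (\<integral>\<^sup>+x. ennreal (f x) * indicator A x \<partial>lborel)"
  by (simp add: law_def emeasure_density)

lemma nn_integral_law:
  "\<psi> \<in> borel_measurable borel \<Longrightarrow> (\<integral>\<^sup>+x. \<psi> x \<partial>law f) = (\<integral>\<^sup>+x. ennreal (f x) * \<psi> x \<partial>lborel)"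
  unfolding law_def by (rule nn_integral_density) auto

lemma isCont_F: "isCont F x"
proof -
  have "AE y in lborel. ennreal (f y) * indicator {x} y = 0"
    using AE_lborel_singleton[of x] by eventually_elim simp
  then have "emeasure (law f) {x} = 0"
    by (simp add: emeasure_law nn_integral_0_iff_AE)
  then show ?thesis
    by (simp add: isCont_cdf measure_def)
qed

lemma F_measurable [measurable]: "F \<in> borel_measurable borel"
  using isCont_F by (intro borel_measurable_continuous_onI continuous_at_imp_continuous_on) auto

lemma F_nonneg: "0 \<le> F x" and F_le_one: "F x \<le> 1" and F_mono: "x \<le> y \<Longrightarrow> F x \<le> F y"
  by (simp_all add: cdf_nonneg cdf_bounded_prob cdf_nondecreasing)

text \<open>The exceptional point \<open>c\<close> covers the end point 0 of \<open>{..0}\<close>,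
  where \<open>f\<close> may be positive.\<close>

lemma emeasure_law_eq_0:
  assumes [measurable]: "A \<in> sets borel" and "\<And>x. x \<in> A \<Longrightarrow> x = c \<or> f x = 0"
  shows "emeasure (law f) A = 0"
proof -
  have "AE y in lborel. ennreal (f y) * indicator A y = 0"
    using AE_lborel_singleton[of c] by eventually_elim (use assms(2) in \<open>force split: split_indicator\<close>)
  then show ?thesis
    by (simp add: emeasure_law nn_integral_0_iff_AE)
qed

lemma F_zero: "F 0 = 0"
proof -
  have "emeasure (law f) {..0} = 0"
    using D_nonneg f_outside by (intro emeasure_law_eq_0[of _ 0]) force+
  then show ?thesis by (simp add: cdf_def measure_def)
qed

lemma F_eq_one_above:
  assumes "\<And>t. x < t \<Longrightarrow> f t = 0"
  shows "F x = 1"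
proof -
  have "emeasure (law f) {x<..} = 0"
    using assms by (intro emeasure_law_eq_0) auto
  then have "prob (space (law f) - {..x}) = 0"
    by (simp add: measure_def Compl_eq_Diff_UNIV[symmetric])
  then show ?thesis
    using prob_compl[of "{..x}"] by (simp add: cdf_def)
qed

lemma F_attains:
  assumes "0 \<le> u" "u < 1"
  obtains t where "0 \<le> t" "F t = u"
proof -
  have "eventually (\<lambda>x. F x > u) at_top"
    using cdf_lim_at_top_prob assms(2) by (rule order_tendstoD)
  then obtain b where "0 \<le> b" "F b > u"
    by (metis eventually_at_top_linorder linorder_linear)
  then show thesis
    using IVT[of F 0 u b] F_zero assms isCont_F that by auto
qed

text \<open>\<open>F\<close> may have flat pieces, so the set need not be \<open>{..t}\<close> for a
  given \<open>t\<close> with \<open>F t = u\<close>. It contains that half-line and lies in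
  \<open>{..t}\<close> for every \<open>t\<close> with \<open>F t\<close> in
  \<open>{u<..<1}\<close>; continuity of \<open>F\<close> supplies such points.\<close>

lemma prob_F_le:
  assumes "0 \<le> u" "u < 1"
  shows "prob {x. F x \<le> u} = u"
proof (rule antisym)
  show "prob {x. F x \<le> u} \<le> u"
  proof (rule dense_ge_bounded[OF assms(2)])
    fix v assume v: "u < v" "v < 1"
    then obtain t where t: "F t = v" using F_attains[of v] assms by auto
    have "{x. F x \<le> u} \<subseteq> {..t}"
      using F_mono[of t] v t by (auto simp: not_le[symmetric]) (metis not_le order_trans linorder_linear)
    then have "prob {x. F x \<le> u} \<le> F t"
      unfolding cdf_def2[of _ t] by (intro finite_measure_mono) auto
    then show "prob {x. F x \<le> u} \<le> v" using t by simp
  qed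
  obtain t where t: "F t = u" using F_attains[OF assms] .
  then have "prob {..t} \<le> prob {x. F x \<le> u}"
    using F_mono by (intro finite_measure_mono) auto
  then show "u \<le> prob {x. F x \<le> u}" using t by (simp add: cdf_def2)
qed

text \<open>Moves integrals of functions of \<open>F\<close> to Lebesgue integrals over
  \<open>[0, 1]\<close>. This replaces differentiating \<open>F\<close>, which for a merely
  measurable density is possible only almost everywhere.\<close>

lemma probability_integral_transform:
  "distr (law f) borel F = uniform_measure lborel {0..1}"
proof (rule cdf_unique)
  show "real_distribution (distr (law f) borel F)"
    by (intro real_distribution_distr) simp
  interpret U: prob_space "uniform_measure lborel {0..1::real}"
    by (rule prob_space_uniform_measure) auto
  show "real_distribution (uniform_measure lborel {0..1::real})"
    by standard simp
  show "cdf (distr (law f) borel F) = cdf (uniform_measure lborel {0..1})"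
  proof
    fix u :: real
    have "cdf (distr (law f) borel F) u = prob {x. F x \<le> u}"
      by (simp add: cdf_def2[of "distr (law f) borel F"] measure_distr vimage_def)
    also have "\<dots> = min 1 (max 0 u)"
    proof -
      consider "u < 0" | "0 \<le> u" "u < 1" | "1 \<le> u" by linarith
      then show ?thesis
      proof cases
        case 1
        then have "{x. F x \<le> u} = {}"
          using F_nonneg by (auto simp: not_le intro: less_le_trans)
        with 1 show ?thesis by simp
      next
        case 2
        then show ?thesis by (simp add: prob_F_le)
      next
        case 3
        then have "{x. F x \<le> u} = space (law f)"
          using F_le_one order_trans by auto
        with 3 show ?thesis by (simp only: prob_space)
      qed
    qed
    also have "\<dots> = cdf (uniform_measure lborel {0..1}) u"
    proof -
      have "{0..1} \<inter> {..u} = {0..min 1 u}" by auto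
      then show ?thesis by (simp add: cdf_def measure_uniform_measure)
    qed
    finally show "cdf (distr (law f) borel F) u = cdf (uniform_measure lborel {0..1}) u" .
  qed
qed

lemma nn_integral_F:
  assumes [measurable]: "\<psi> \<in> borel_measurable borel"
  shows "(\<integral>\<^sup>+x. \<psi> (F x) \<partial>law f) = (\<integral>\<^sup>+u. \<psi> u * indicator {0..1} u \<partial>lborel)"
proof -
  have "(\<integral>\<^sup>+x. \<psi> (F x) \<partial>law f) = (\<integral>\<^sup>+u. \<psi> u \<partial>distr (law f) borel F)"
    by (subst nn_integral_distr) auto
  then show ?thesis
    by (simp add: probability_integral_transform nn_integral_uniform_measure divide_ennreal_def)
qed

text \<open>Off the level sets of \<open>F\<close> at the end points, membership of \<open>x\<close>
  in an interval is equivalent to a condition on \<open>F x\<close> alone, as the next two lemmas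
  require.\<close>

lemma AE_F_neq: "AE x in law f. F x \<noteq> c"
proof -
  have "AE u in distr (law f) borel F. u \<noteq> c"
    unfolding probability_integral_transform
    using AE_lborel_singleton[of c] by (subst AE_uniform_measure) auto
  then show ?thesis
    by (subst (asm) AE_distr_iff) auto
qed

lemma nn_integral_F_atMost:
  assumes [measurable]: "\<psi> \<in> borel_measurable borel"
  shows "(\<integral>\<^sup>+x. \<psi> (F x) * indicator {..y} x \<partial>law f) = (\<integral>\<^sup>+u. \<psi> u * indicator {0..F y} u \<partial>lborel)"
proof -
  have "(\<integral>\<^sup>+x. \<psi> (F x) * indicator {..y} x \<partial>law f) = (\<integral>\<^sup>+x. \<psi> (F x) * indicator {..F y} (F x) \<partial>law f)"
  proof (rule nn_integral_cong_AE)
    show "AE x in law f. \<psi> (F x) * indicator {..y} x = \<psi> (F x) * indicator {..F y} (F x)"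
      using AE_F_neq[of "F y"]
    proof eventually_elim
      case (elim x)
      then show ?case
        using F_mono[of x y] F_mono[of y x] by (auto split: split_indicator)
    qed
  qed
  also have "\<dots> = (\<integral>\<^sup>+u. \<psi> u * indicator {..F y} u * indicator {0..1} u \<partial>lborel)"
    by (rule nn_integral_F) measurable
  also have "\<dots> = (\<integral>\<^sup>+u. \<psi> u * indicator {0..F y} u \<partial>lborel)"
    using F_le_one[of y] by (intro nn_integral_cong) (auto split: split_indicator)
  finally show ?thesis .
qed

lemma nn_integral_F_Ioc:
  assumes [measurable]: "\<psi> \<in> borel_measurable borel"
  shows "(\<integral>\<^sup>+t. \<psi> (F t) * indicator {x<..y} t \<partial>law f) = (\<integral>\<^sup>+u. \<psi> u * indicator {F x..F y} u \<partial>lborel)"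
proof -
  have "(\<integral>\<^sup>+t. \<psi> (F t) * indicator {x<..y} t \<partial>law f) = (\<integral>\<^sup>+t. \<psi> (F t) * indicator {F x..F y} (F t) \<partial>law f)"
  proof (rule nn_integral_cong_AE)
    show "AE t in law f. \<psi> (F t) * indicator {x<..y} t = \<psi> (F t) * indicator {F x..F y} (F t)"
      using AE_F_neq[of "F y"] AE_F_neq[of "F x"]
    proof eventually_elim
      case (elim t)
      then show ?case
        using F_mono[of t y] F_mono[of y t] F_mono[of x t] F_mono[of t x] by (auto split: split_indicator)
    qed
  qed
  also have "\<dots> = (\<integral>\<^sup>+u. \<psi> u * indicator {F x..F y} u * indicator {0..1} u \<partial>lborel)"
    by (rule nn_integral_F) measurable
  also have "\<dots> = (\<integral>\<^sup>+u. \<psi> u * indicator {F x..F y} u \<partial>lborel)"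
    using F_le_one[of y] F_nonneg[of x] by (intro nn_integral_cong) (auto split: split_indicator)
  finally show ?thesis .
qed

section \<open>Joint law of the valuations and of their order statistics\<close>

lemma space_valuations: "space (valuations f n) = {..<n} \<rightarrow>\<^sub>E UNIV"
  by (simp add: valuations_def space_PiM)

lemma prob_space_valuations: "prob_space (valuations f n)"
  unfolding valuations_def by (rule prob_space_PiM) (rule prob_space_axioms)

lemma box_valuations:
  assumes "\<And>i. i < n \<Longrightarrow> A i \<in> sets borel"
  shows "Pi\<^sub>E {..<n} A \<in> sets (valuations f n)"
    "measure (valuations f n) (Pi\<^sub>E {..<n} A) = (\<Prod>i<n. prob (A i))"
proof -
  interpret P: finite_product_prob_space "\<lambda>_. law f" "{..<n}"
    by standard auto
  show "Pi\<^sub>E {..<n} A \<in> sets (valuations f n)"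
    unfolding valuations_def using assms by (intro sets_PiM_I_finite) (simp_all add: events_eq_borel)
  show "measure (valuations f n) (Pi\<^sub>E {..<n} A) = (\<Prod>i<n. prob (A i))"
    unfolding valuations_def using assms by (intro P.prob_times) (simp add: events_eq_borel)
qed

lemma maximum_le_event:
  assumes "1 \<le> n"
  shows "{v \<in> space (valuations f n). order_stat n n v \<le> y} = Pi\<^sub>E {..<n} (\<lambda>_. {..y})"
  unfolding space_valuations maximum_le_iff[OF assms]
  by (intro set_eqI) (simp add: PiE_iff Ball_def, blast)

lemma measurable_maximum:
  "1 \<le> n \<Longrightarrow> order_stat n n \<in> borel_measurable (valuations f n)"
  unfolding borel_measurable_iff_le by (auto simp only: maximum_le_event intro!: box_valuations atMost_borel)

lemma maximum_le_prob:
  "1 \<le> n \<Longrightarrow> measure (valuations f n) {v \<in> space (valuations f n). order_stat n n v \<le> y} = F y ^ n"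
  by (simp only: maximum_le_event) (subst box_valuations, simp_all add: cdf_def2)

definition one_above :: "nat \<Rightarrow> real \<Rightarrow> nat \<Rightarrow> (nat \<Rightarrow> real) set" where
  "one_above n y j = Pi\<^sub>E {..<n} (\<lambda>i. if i = j then {y<..} else {..y})"

lemma second_highest_le_event:
  assumes "2 \<le> n"
  shows "{v \<in> space (valuations f n). order_stat (n - 1) n v \<le> y} =
    Pi\<^sub>E {..<n} (\<lambda>_. {..y}) \<union> (\<Union>j<n. one_above n y j)"
proof -
  have "v \<in> one_above n y j \<longleftrightarrow>
      v \<in> extensional {..<n} \<and> (\<forall>i<n. if i = j then y < v i else v i \<le> y)" for v j
    unfolding one_above_def PiE_iff by (auto split: if_splits)
  then show ?thesis
    unfolding second_highest_le_iff[OF assms] space_valuations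
    by (intro set_eqI) (simp add: PiE_iff Ball_def Bex_def, blast)
qed

lemma measurable_second_highest:
  assumes "2 \<le> n"
  shows "order_stat (n - 1) n \<in> borel_measurable (valuations f n)"
  unfolding borel_measurable_iff_le second_highest_le_event[OF assms] one_above_def
  by (intro allI sets.Un sets.finite_UN box_valuations) auto

lemma second_highest_le_prob:
  assumes n: "2 \<le> n"
  shows "measure (valuations f n) {v \<in> space (valuations f n). order_stat (n - 1) n v \<le> y} =
    F y ^ n + real n * F y ^ (n - 1) * (1 - F y)"
proof -
  interpret V: prob_space "valuations f n" by (rule prob_space_valuations)
  have meas: "one_above n y j \<in> V.events" for j
    unfolding one_above_def by (intro box_valuations) auto
  have "prob {y<..} = 1 - F y"
    using prob_compl[of "{..y}"] by (simp add: cdf_def2 Compl_eq_Diff_UNIV[symmetric])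
  then have one: "V.prob (one_above n y j) = F y ^ (n - 1) * (1 - F y)" if "j < n" for j
    using that unfolding one_above_def
    by (subst box_valuations) (simp_all add: prod.remove[of "{..<n}" j] cdf_def2)
  have above: "y < v j" if "v \<in> one_above n y j" "j < n" for v j
    using PiE_mem[OF that(1)[unfolded one_above_def], of j] that(2) by simp
  have below: "v i \<le> y" if "v \<in> one_above n y j" "i < n" "i \<noteq> j" for v i j
    using PiE_mem[OF that(1)[unfolded one_above_def], of i] that(2,3) by simp
  have "disjoint_family_on (one_above n y) {..<n}"
    unfolding disjoint_family_on_def using above below by (fastforce simp flip: not_less)
  then have "V.prob (\<Union>j<n. one_above n y j) = (\<Sum>j<n. V.prob (one_above n y j))"
    using meas by (intro V.finite_measure_finite_Union) auto
  also have "\<dots> = real n * F y ^ (n - 1) * (1 - F y)"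
    by (simp add: one)
  finally have U: "V.prob (\<Union>j<n. one_above n y j) = real n * F y ^ (n - 1) * (1 - F y)" .
  have "Pi\<^sub>E {..<n} (\<lambda>_. {..y}) \<inter> (\<Union>j<n. one_above n y j) = {}"
    using above by (fastforce simp: PiE_iff simp flip: not_less)
  then have "V.prob (Pi\<^sub>E {..<n} (\<lambda>_. {..y}) \<union> (\<Union>j<n. one_above n y j)) =
      V.prob (Pi\<^sub>E {..<n} (\<lambda>_. {..y})) + V.prob (\<Union>j<n. one_above n y j)"
    using meas by (intro V.finite_measure_Union box_valuations) auto
  then show ?thesis
    unfolding second_highest_le_event[OF n] by (simp add: U box_valuations cdf_def2)
qed

text \<open>Both measures have cdf \<open>F y ^ n\<close>; on the right the transform reduces it to
  the integral of \<open>n * u ^ (n - 1)\<close> over \<open>[0, F y]\<close>.\<close>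

lemma law_maximum:
  assumes n: "1 \<le> n"
  shows "distr (valuations f n) borel (order_stat n n) =
    density (law f) (\<lambda>x. ennreal (real n * F x ^ (n - 1)))"
proof (rule cdf_unique)
  interpret V: prob_space "valuations f n" by (rule prob_space_valuations)
  let ?M = "density (law f) (\<lambda>x. ennreal (real n * F x ^ (n - 1)))"
  have power: "(\<integral>\<^sup>+u. ennreal (real n * u ^ (n - 1)) * indicator {0..v} u \<partial>lborel) = ennreal (v ^ n)"
    if "0 \<le> v" for v :: real
    using nn_integral_FTC_Icc[of "\<lambda>u. real n * u ^ (n - 1)" 0 v "\<lambda>u. u ^ n"] that n
    by (auto intro!: derivative_eq_intros)
  show "real_distribution (distr (valuations f n) borel (order_stat n n))"
    by (intro V.real_distribution_distr measurable_maximum n)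
  have "emeasure ?M (space ?M) = 1"
    using nn_integral_F[of "\<lambda>u. ennreal (real n * u ^ (n - 1))"] power[of 1]
    by (simp add: emeasure_density)
  then interpret M: prob_space ?M by standard
  show "real_distribution ?M"
    by standard simp
  show "cdf (distr (valuations f n) borel (order_stat n n)) = cdf ?M"
  proof
    fix y
    have "emeasure ?M {..y} = ennreal (F y ^ n)"
      using nn_integral_F_atMost[of "\<lambda>u. ennreal (real n * u ^ (n - 1))" y] power[of "F y"] F_nonneg[of y]
      by (simp add: emeasure_density)
    then have "cdf ?M y = F y ^ n"
      using F_nonneg by (simp add: cdf_def2 measure_def)
    also have "\<dots> = cdf (distr (valuations f n) borel (order_stat n n)) y"
      using maximum_le_prob[OF n, of y] measurable_maximum[OF n]
      by (simp add: cdf_def2 measure_distr vimage_def Int_def conj_commute)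
    finally show "cdf (distr (valuations f n) borel (order_stat n n)) y = cdf ?M y" by simp
  qed
qed

end

subsection \<open>Monotone hazard rate\<close>

locale mhr_density = valuation_density +
  assumes mhr: "MHR f D"
begin

text \<open>The value where \<open>F x = 1\<close> is a filler; comparisons of hazard rates below
  are restricted to points with \<open>F < 1\<close>.\<close>

definition hazard :: "real \<Rightarrow> real" where
  "hazard x = (if F x < 1 then f x / (1 - F x) else 0)"

definition cum_hazard :: "real \<Rightarrow> real" where
  "cum_hazard x = - ln (1 - F x)"

lemma hazard_nonneg: "0 \<le> hazard x"
  using f_nonneg by (simp add: hazard_def)

text \<open>Extends monotonicity from \<open>D\<close> to the whole line: off \<open>D\<close> the
  rate is 0, and a point to the right of all of \<open>D\<close> would have
  \<open>F y = 1\<close>.\<close>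

lemma hazard_mono:
  assumes "x \<le> y" "F y < 1"
  shows "hazard x \<le> hazard y"
proof (cases "x \<in> D")
  case True
  have "y \<in> D"
  proof (rule ccontr)
    assume "y \<notin> D"
    then have "t \<notin> D" if "y < t" for t
      using that mem_is_interval_1_I[OF D_interval True, of t y] assms(1) by auto
    then have "F y = 1"
      using f_outside by (intro F_eq_one_above) auto
    then show False using assms(2) by simp
  qed
  moreover have "F x < 1"
    using assms F_mono[of x y] by simp
  ultimately show ?thesis
    using mhr assms True by (auto simp: MHR_def mono_on_def hazard_def)
next
  case False
  then have "hazard x = 0"
    using f_outside by (simp add: hazard_def)
  then show ?thesis
    using hazard_nonneg by simp
qed

text \<open>The convexity of \<open>cum_hazard\<close> as supporting-line inequalities. Its
  increment is the integral of \<open>hazard\<close> over \<open>{x<..y}\<close>, and the monotone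
  integrand is bounded by its end values.\<close>

lemma hazard_bounds:
  assumes "x \<le> y" "F y < 1"
  shows "hazard x * (y - x) \<le> cum_hazard y - cum_hazard x"
    and "cum_hazard y - cum_hazard x \<le> hazard y * (y - x)"
proof -
  have Fxy: "0 \<le> F x" "F x \<le> F y"
    using F_nonneg F_mono assms by auto
  \<comment> \<open>The \<open>max\<close> keeps the integrand bounded on all reals and equal to
    \<open>1 / (1 - u)\<close> for \<open>u \<le> F y\<close>.\<close>
  have "(\<integral>\<^sup>+u. ennreal (1 / (max (1 - F y) (1 - u))) * indicator {F x..F y} u \<partial>lborel) =
      ennreal (cum_hazard y - cum_hazard x)"
  proof -
    have "((\<lambda>u. - ln (1 - u)) has_real_derivative 1 / (max (1 - F y) (1 - u))) (at u)" if "u \<le> F y" for u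
      using that assms(2) by (auto intro!: derivative_eq_intros simp: max_def)
    then show ?thesis
      using Fxy assms(2) by (subst nn_integral_FTC_Icc) (auto simp: cum_hazard_def max_def)
  qed
  moreover have "(\<integral>\<^sup>+u. ennreal (1 / (max (1 - F y) (1 - u))) * indicator {F x..F y} u \<partial>lborel) =
      (\<integral>\<^sup>+t. ennreal (1 / (max (1 - F y) (1 - F t))) * indicator {x<..y} t \<partial>law f)"
    by (rule nn_integral_F_Ioc[symmetric]) measurable
  moreover have "\<dots> = (\<integral>\<^sup>+t. ennreal (hazard t) * indicator {x<..y} t \<partial>lborel)"
  proof -
    have "F t < 1 \<and> 1 - F y \<le> 1 - F t" if "t \<le> y" for t
      using F_mono[OF that] assms(2) by simp
    then show ?thesis
      using f_nonneg
      by (subst nn_integral_law, measurable, intro nn_integral_cong)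
        (auto simp: hazard_def ennreal_mult'[symmetric] max_absorb2 split: split_indicator)
  qed
  ultimately have eq: "ennreal (cum_hazard y - cum_hazard x) = (\<integral>\<^sup>+t. ennreal (hazard t) * indicator {x<..y} t \<partial>lborel)"
    by simp
  have const: "(\<integral>\<^sup>+t. ennreal c * indicator {x<..y} t \<partial>lborel) = ennreal (c * (y - x))" if "0 \<le> c" for c
    using that assms(1) by (simp add: nn_integral_cmult ennreal_mult')
  have "ennreal (hazard x * (y - x)) \<le> ennreal (cum_hazard y - cum_hazard x)"
    unfolding eq const[OF hazard_nonneg, symmetric]
  proof (intro nn_integral_mono)
    fix t
    have "hazard x \<le> hazard t" if "x < t" "t \<le> y"
      using hazard_mono[of x t] F_mono[of t y] that assms by simp
    then show "ennreal (hazard x) * indicator {x<..y} t \<le> ennreal (hazard t) * indicator {x<..y} t"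
      by (auto split: split_indicator intro: ennreal_leI)
  qed
  moreover have le: "0 \<le> cum_hazard y - cum_hazard x"
    using Fxy assms(2) by (simp add: cum_hazard_def)
  ultimately show "hazard x * (y - x) \<le> cum_hazard y - cum_hazard x"
    by (simp add: ennreal_le_iff)
  have "ennreal (cum_hazard y - cum_hazard x) \<le> ennreal (hazard y * (y - x))"
    unfolding eq const[OF hazard_nonneg, symmetric]
    using assms hazard_mono by (intro nn_integral_mono) (auto split: split_indicator intro!: ennreal_leI)
  then show "cum_hazard y - cum_hazard x \<le> hazard y * (y - x)"
    using hazard_nonneg assms by (subst (asm) ennreal_le_iff) auto
qed

lemma F_eq_cum_hazard: "F x < 1 \<Longrightarrow> F x = 1 - exp (- cum_hazard x)"
  by (simp add: cum_hazard_def)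

lemma cum_hazard_zero: "cum_hazard 0 = 0"
  by (simp add: cum_hazard_def F_zero)

lemma cum_hazard_nonneg: "F x < 1 \<Longrightarrow> 0 \<le> cum_hazard x"
  using F_nonneg[of x] by (simp add: cum_hazard_def)

text \<open>Continuity of \<open>F\<close> gives \<open>m\<close>. The last conclusion says that the
  tangent of \<open>cum_hazard\<close> at \<open>m\<close> has a nonnegative zero.\<close>

lemma cum_hazard_attains:
  assumes "0 < c"
  obtains m where "0 < m" "F m < 1" "cum_hazard m = c" "0 < hazard m" "c \<le> hazard m * m"
proof -
  obtain m where m: "0 \<le> m" "F m = 1 - exp (- c)"
    using F_attains[of "1 - exp (- c)"] assms by auto
  then have m': "F m < 1" "cum_hazard m = c" by (simp_all add: cum_hazard_def)
  then have h: "c \<le> hazard m * m"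
    using hazard_bounds(2)[of 0 m] m cum_hazard_zero by simp
  then have "0 < hazard m * m" using assms by simp
  then have "0 < hazard m" "0 < m"
    using m(1) hazard_nonneg[of m] by (auto simp: zero_less_mult_iff)
  then show thesis using that m' h by blast
qed

text \<open>The chord bound from the origin, in product form to avoid dividing by \<open>x\<close>
  or \<open>y\<close>.\<close>

lemma cum_hazard_star:
  assumes "0 \<le> x" "x \<le> y" "F y < 1"
  shows "cum_hazard x * y \<le> x * cum_hazard y"
proof -
  have "F x < 1" using F_mono[of x y] assms by simp
  then have "cum_hazard x * (y - x) \<le> hazard x * x * (y - x)"
    using hazard_bounds(2)[of 0 x] assms cum_hazard_zero by (intro mult_right_mono) auto
  also have "\<dots> = x * (hazard x * (y - x))" by simp
  also have "\<dots> \<le> x * (cum_hazard y - cum_hazard x)"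
    using hazard_bounds(1)[of x y] assms by (intro mult_left_mono) auto
  finally show ?thesis by (simp add: algebra_simps)
qed

lemma F_ge_tangent:
  assumes "F m < 1"
  shows "1 - exp (- (cum_hazard m + hazard m * (t - m))) \<le> F t"
proof (cases "F t < 1")
  case True
  have "cum_hazard m + hazard m * (t - m) \<le> cum_hazard t"
  proof (cases "m \<le> t")
    case True
    then show ?thesis using hazard_bounds(1)[of m t] \<open>F t < 1\<close> by simp
  next
    case False
    then show ?thesis using hazard_bounds(2)[of t m] assms by (simp add: algebra_simps)
  qed
  then show ?thesis
    using F_eq_cum_hazard[OF True] by simp
next
  case False
  then show ?thesis using exp_gt_zero[of "- (cum_hazard m + hazard m * (t - m))"] by linarith
qed

text \<open>Taken in \<open>ennreal\<close> because finiteness at \<open>r = 0\<close> is known only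
  after comparison with an exponential tail.\<close>

definition second_tail_integral :: "nat \<Rightarrow> real \<Rightarrow> ennreal" where
  "second_tail_integral n r = (\<integral>\<^sup>+t. ennreal (second_tail n (F t)) * indicator {r..} t \<partial>lborel)"

lemma second_tail_measurable [measurable]: "second_tail n \<in> borel_measurable borel"
  unfolding second_tail_def[abs_def] by measurable

text \<open>The tangent at \<open>m\<close> gives an exponential distribution started at its zero
  \<open>x0 = m - (harm n - 1) / a\<close>. The integrand is at most 1 up to \<open>x0\<close>, and
  the exponential part contributes \<open>(harm n - 1) / a\<close>; the two add up to
  \<open>m\<close>.\<close>

lemma second_tail_integral_le:
  assumes n: "n \<ge> 2" and m: "F m < 1" "0 < hazard m" "cum_hazard m = harm n - 1" "0 < m"
    "harm n - 1 \<le> hazard m * m"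
  shows "second_tail_integral n 0 \<le> ennreal m"
proof -
  define a x0 where "a = hazard m" and "x0 = m - (harm n - 1) / a"
  have a: "0 < a" using m by (simp add: a_def)
  have x0: "0 \<le> x0" using m a by (simp add: x0_def a_def field_simps)
  let ?E = "\<lambda>t. 1 - exp (- (a * (t - x0)))"
  have E: "?E t \<le> F t" for t
  proof -
    have "harm n - 1 + a * (t - m) = a * (t - x0)"
      using a by (simp add: x0_def field_simps)
    then show ?thesis
      using F_ge_tangent[OF m(1), of t] by (simp only: m(3) a_def)
  qed
  have T1: "second_tail n (F t) \<le> 1" for t
    using second_tail_le_one[OF F_nonneg F_le_one] .
  have ET: "second_tail n (F t) \<le> second_tail n (?E t)" if "x0 \<le> t" for t
    using that a by (intro second_tail_antimono E F_le_one n) auto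
  have "second_tail_integral n 0 \<le>
      (\<integral>\<^sup>+t. indicator {0..x0} t + ennreal (second_tail n (?E t)) * indicator {x0..} t \<partial>lborel)"
    unfolding second_tail_integral_def
    using T1 ET by (intro nn_integral_mono) (auto split: split_indicator intro: add_increasing2 ennreal_leI)
  also have "\<dots> = ennreal x0 + (\<integral>\<^sup>+t. ennreal (second_tail n (?E t)) * indicator {x0..} t \<partial>lborel)"
    using x0 by (subst nn_integral_add) auto
  also have "(\<integral>\<^sup>+t. ennreal (second_tail n (?E t)) * indicator {x0..} t \<partial>lborel) =
      ennreal (second_tail_prim n 1 / a - second_tail_prim n (?E x0) / a)"
  proof (rule nn_integral_FTC_atLeast[where F = "\<lambda>t. second_tail_prim n (?E t) / a"])
    show "((\<lambda>t. second_tail_prim n (?E t) / a) \<longlongrightarrow> second_tail_prim n 1 / a) at_top"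
    proof (intro tendsto_divide tendsto_const)
      have "(?E \<longlongrightarrow> 1) at_top"
        using a by real_asymp
      moreover have "isCont (second_tail_prim n) 1"
        using DERIV_second_tail_prim DERIV_isCont by blast
      ultimately show "((\<lambda>t. second_tail_prim n (?E t)) \<longlongrightarrow> second_tail_prim n 1) at_top"
        by (metis isCont_tendsto_compose)
    qed (use a in simp)
    show "((\<lambda>t. second_tail_prim n (?E t) / a) has_real_derivative second_tail n (?E t)) (at t)" for t
      by (rule DERIV_second_tail_prim_exp[OF a])
    show "0 \<le> second_tail n (?E t)" if "x0 \<le> t" for t
      using that a n by (intro second_tail_nonneg) auto
    show "(\<lambda>t. second_tail n (?E t)) \<in> borel_measurable borel"
      by measurable
  qed
  also have "second_tail_prim n 1 = harm n - 1"
    by (simp add: second_tail_prim_def harm_def inverse_eq_divide)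
  also have "second_tail_prim n (?E x0) = 0"
    using n by (simp add: second_tail_prim_def sum.neutral power_0_left)
  finally have "second_tail_integral n 0 \<le> ennreal x0 + ennreal ((harm n - 1) / a)"
    by simp
  also have "\<dots> = ennreal m"
    using a x0 harm_bounds(1)[OF n] by (subst ennreal_plus[symmetric]) (auto simp: x0_def)
  finally show ?thesis .
qed

text \<open>The tangent where \<open>cum_hazard m = 1\<close> dominates the survival function by an
  exponential. The finiteness allows a cancellation in \<open>Myerson_le\<close>.\<close>

lemma survival_integrable:
  "(\<integral>\<^sup>+t. ennreal (1 - F t) * indicator {0..} t \<partial>lborel) < \<infinity>"
proof -
  obtain m where m: "0 < m" "F m < 1" "cum_hazard m = 1" "0 < hazard m"
    using cum_hazard_attains[of 1] by auto
  define a where "a = hazard m"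
  have a: "0 < a" using m by (simp add: a_def)
  let ?E = "\<lambda>t. exp (- (1 + a * (t - m)))"
  have "1 - F t \<le> ?E t" for t
    using F_ge_tangent[OF m(2), of t] by (simp add: m(3) a_def)
  then have "(\<integral>\<^sup>+t. ennreal (1 - F t) * indicator {0..} t \<partial>lborel) \<le>
      (\<integral>\<^sup>+t. ennreal (?E t) * indicator {0..} t \<partial>lborel)"
    by (intro nn_integral_mono) (auto split: split_indicator intro: ennreal_leI)
  also have "\<dots> = ennreal (0 - (- (?E 0 / a)))"
  proof (rule nn_integral_FTC_atLeast)
    show "((\<lambda>t. - (?E t / a)) has_real_derivative ?E t) (at t)" for t
      using a by (auto intro!: derivative_eq_intros)
    show "((\<lambda>t. - (?E t / a)) \<longlongrightarrow> 0) at_top"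
      using a by real_asymp
  qed auto
  finally show ?thesis
    by (rule le_less_trans) simp
qed

text \<open>Layer-cake formula at 0; the order statistic is almost surely positive since
  \<open>second_tail n 0 = 1\<close>. The finiteness hypothesis rules out the default value 0 of a
  divergent integral.\<close>

lemma expected_second_highest:
  assumes n: "n \<ge> 2" and fin: "second_tail_integral n 0 < \<infinity>"
  shows "ennreal (expected_order_stat f (n - 1) n) = second_tail_integral n 0"
    "0 \<le> expected_order_stat f (n - 1) n"
proof -
  interpret V: prob_space "valuations f n" by (rule prob_space_valuations)
  let ?X = "order_stat (n - 1) n"
  note [measurable] = measurable_second_highest[OF n]
  have gt: "emeasure (valuations f n) {v \<in> space (valuations f n). y < ?X v} = ennreal (second_tail n (F y))" for y
  proof -
    have "V.prob {v \<in> space (valuations f n). y < ?X v} = 1 - V.prob {v \<in> space (valuations f n). ?X v \<le> y}"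
      by (subst V.prob_compl[symmetric], measurable) (auto intro!: arg_cong[of _ _ V.prob])
    also have "\<dots> = second_tail n (F y)"
      unfolding second_highest_le_prob[OF n] second_tail_def by simp
    finally show ?thesis
      by (simp add: V.emeasure_eq_measure)
  qed
  have "V.prob {v \<in> space (valuations f n). 0 < ?X v} = 1"
    using gt[of 0] n by (simp add: V.emeasure_eq_measure F_zero second_tail_zero)
  moreover have "{v \<in> space (valuations f n). 0 < ?X v} \<in> V.events"
    by measurable
  ultimately have "AE v in valuations f n. 0 < ?X v"
    by (simp only: V.prob_Collect_eq_1)
  then have nonneg: "AE v in valuations f n. 0 \<le> ?X v"
    by eventually_elim simp
  have "(\<integral>\<^sup>+v. ennreal (?X v) \<partial>valuations f n) = second_tail_integral n 0"
    using V.nn_integral_tail[OF measurable_second_highest[OF n], of 0]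
    unfolding gt second_tail_integral_def by simp
  moreover have "expected_order_stat f (n - 1) n = enn2real (\<integral>\<^sup>+v. ennreal (?X v) \<partial>valuations f n)"
    unfolding expected_order_stat_def by (rule integral_eq_nn_integral[OF measurable_second_highest[OF n] nonneg])
  ultimately show "ennreal (expected_order_stat f (n - 1) n) = second_tail_integral n 0"
    "0 \<le> expected_order_stat f (n - 1) n"
    using fin by (simp_all add: ennreal_enn2real_if less_top)
qed

section \<open>The optimal revenue\<close>

lemma nn_integral_law_maximum:
  assumes n: "n \<ge> 1" and [measurable]: "\<psi> \<in> borel_measurable borel"
  shows "(\<integral>\<^sup>+v. \<psi> (order_stat n n v) \<partial>valuations f n) =
    (\<integral>\<^sup>+x. ennreal (real n * F x ^ (n - 1) * f x) * \<psi> x \<partial>lborel)"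
proof -
  have "(\<integral>\<^sup>+v. \<psi> (order_stat n n v) \<partial>valuations f n) =
      (\<integral>\<^sup>+x. \<psi> x \<partial>density (law f) (\<lambda>x. ennreal (real n * F x ^ (n - 1))))"
    unfolding law_maximum[OF n, symmetric]
    by (subst nn_integral_distr) (auto intro: measurable_maximum n)
  also have "\<dots> = (\<integral>\<^sup>+x. ennreal (f x) * (ennreal (real n * F x ^ (n - 1)) * \<psi> x) \<partial>lborel)"
    by (subst nn_integral_density, measurable) (subst nn_integral_law, measurable)
  also have "\<dots> = (\<integral>\<^sup>+x. ennreal (real n * F x ^ (n - 1) * f x) * \<psi> x \<partial>lborel)"
    using F_nonneg f_nonneg by (intro nn_integral_cong) (simp add: ennreal_mult' ennreal_mult'' mult_ac)
  finally show ?thesis .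
qed

text \<open>Off the null event that the maximum equals \<open>r\<close>, the integrand is
  \<open>r\<close> on the event of exceeding \<open>r\<close> plus the positive excess over
  \<open>r\<close>.\<close>

lemma maximum_tail:
  assumes n: "n \<ge> 1" and r: "0 \<le> r"
  shows "(\<integral>\<^sup>+v. ennreal (order_stat n n v) * indicator {r..} (order_stat n n v) \<partial>valuations f n) =
    ennreal (r * (1 - F r ^ n)) + (\<integral>\<^sup>+t. ennreal (1 - F t ^ n) * indicator {r..} t \<partial>lborel)"
proof -
  interpret V: prob_space "valuations f n" by (rule prob_space_valuations)
  let ?X = "order_stat n n"
  note [measurable] = measurable_maximum[OF n]
  have gt: "emeasure (valuations f n) {v \<in> space (valuations f n). y < ?X v} = ennreal (1 - F y ^ n)" for y
  proof -
    have "V.prob {v \<in> space (valuations f n). y < ?X v} = 1 - V.prob {v \<in> space (valuations f n). ?X v \<le> y}"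
      by (subst V.prob_compl[symmetric], measurable) (auto intro!: arg_cong[of _ _ V.prob])
    then show ?thesis
      by (simp add: V.emeasure_eq_measure maximum_le_prob[OF n])
  qed
  have neq: "AE v in valuations f n. ?X v \<noteq> r"
  proof -
    have "(\<integral>\<^sup>+v. indicator {r} (?X v) \<partial>valuations f n) =
        (\<integral>\<^sup>+x. ennreal (real n * F x ^ (n - 1) * f x) * indicator {r} x \<partial>lborel)"
      by (rule nn_integral_law_maximum[OF n]) measurable
    also have "\<dots> = (\<integral>\<^sup>+x. 0 \<partial>(lborel :: real measure))"
    proof (rule nn_integral_cong_AE)
      show "AE x in lborel. ennreal (real n * F x ^ (n - 1) * f x) * indicator {r} x = 0"
        using AE_lborel_singleton[of r] by eventually_elim simp
    qed
    finally have "AE v in valuations f n. indicator {r} (?X v) = (0::ennreal)"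
      by (subst nn_integral_0_iff_AE[symmetric]) (simp_all, measurable)
    then show ?thesis
      by eventually_elim (auto simp: indicator_def split: if_splits)
  qed
  have "(\<integral>\<^sup>+v. ennreal (?X v) * indicator {r..} (?X v) \<partial>valuations f n) =
      (\<integral>\<^sup>+v. ennreal r * indicator {v \<in> space (valuations f n). r < ?X v} v + ennreal (?X v - r) \<partial>valuations f n)"
  proof (rule nn_integral_cong_AE)
    show "AE v in valuations f n. ennreal (?X v) * indicator {r..} (?X v) =
        ennreal r * indicator {v \<in> space (valuations f n). r < ?X v} v + ennreal (?X v - r)"
      using neq AE_space
    proof eventually_elim
      case (elim v)
      then show ?case
        using r by (cases "r < ?X v") (auto simp: ennreal_neg ennreal_plus[symmetric] simp del: ennreal_plus)
    qed
  qed
  also have "\<dots> = ennreal r * ennreal (1 - F r ^ n) +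
      (\<integral>\<^sup>+t. ennreal (1 - F t ^ n) * indicator {r..} t \<partial>lborel)"
    by (subst nn_integral_add) (simp_all add: nn_integral_cmult V.nn_integral_tail gt)
  finally show ?thesis
    using r by (simp add: ennreal_mult')
qed

text \<open>Where \<open>f x > 0\<close> and \<open>F x < 1\<close>, the virtual valuation has the
  sign of \<open>x * hazard x - 1\<close>, and \<open>x * hazard x\<close> is nondecreasing. The
  density may jump, so \<open>r\<close> is a supremum and no sign is claimed at \<open>r\<close>
  itself.\<close>

lemma reserve_exists:
  obtains r where "0 \<le> r" "F r \<le> 1 - exp (- 1)"
    "\<And>x. 0 \<le> x \<Longrightarrow> x < r \<Longrightarrow> x * hazard x < 1"
    "\<And>x. r < x \<Longrightarrow> F x < 1 \<Longrightarrow> 1 \<le> x * hazard x"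
proof -
  define A where "A = {x. 0 \<le> x \<and> F x < 1 \<and> x * hazard x < 1}"
  define r where "r = Sup A"
  have A0: "0 \<in> A" by (simp add: A_def F_zero)
  obtain m where m: "0 < m" "F m < 1" "0 < hazard m"
    using cum_hazard_attains[of 1] by auto
  have "x \<le> max m (1 / hazard m)" if "x \<in> A" for x
  proof (rule ccontr)
    assume "\<not> x \<le> max m (1 / hazard m)"
    then have x: "m \<le> x" "1 / hazard m < x" by auto
    have "1 < x * hazard m" using x m by (simp add: field_simps)
    also have "\<dots> \<le> x * hazard x"
      using that x by (intro mult_left_mono hazard_mono) (auto simp: A_def)
    finally show False using that by (simp add: A_def)
  qed
  then have bdd: "bdd_above A" by (auto simp: bdd_above_def)
  have r0: "0 \<le> r" unfolding r_def by (rule cSup_upper[OF A0 bdd])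
  have below: "F x < 1 \<and> x * hazard x < 1" if x: "0 \<le> x" "x < r" for x
  proof -
    obtain y where y: "y \<in> A" "x < y"
      using x(2) less_cSup_iff[OF _ bdd] A0 unfolding r_def by blast
    have "x * hazard x \<le> y * hazard y"
      using y x by (intro mult_mono hazard_mono hazard_nonneg) (auto simp: A_def)
    then show ?thesis
      using y F_mono[of x y] by (auto simp: A_def)
  qed
  have above: "1 \<le> x * hazard x" if "r < x" "F x < 1" for x
  proof (rule ccontr)
    assume "\<not> 1 \<le> x * hazard x"
    then have "x \<in> A" using that r0 by (simp add: A_def)
    then show False using cSup_upper[OF _ bdd, of x] that by (simp add: r_def)
  qed
  \<comment> \<open>By continuity, exceeding the bound at \<open>r\<close> would mean exceeding it
    at some \<open>x < r\<close>, where \<open>cum_hazard x \<le> x * hazard x < 1\<close>.\<close>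
  have "F r \<le> 1 - exp (- 1)"
  proof (rule ccontr)
    assume "\<not> F r \<le> 1 - exp (- 1)"
    then obtain u where u: "1 - exp (- 1) < u" "u < F r"
      using dense not_le by metis
    have "F 0 \<le> u"
      using u F_zero exp_le_one_iff[of "-1::real"] by (smt (verit))
    then obtain x where x: "0 \<le> x" "x \<le> r" "F x = u"
      using IVT[of F 0 u r] u r0 isCont_F by auto
    then have "x < r" using u by (cases "x = r") auto
    with below[OF x(1)] have *: "F x < 1" "x * hazard x < 1" by auto
    then have "cum_hazard x \<le> 1"
      using hazard_bounds(2)[of 0 x] x cum_hazard_zero by (simp add: mult.commute)
    then have "F x \<le> 1 - exp (- 1)"
      using F_eq_cum_hazard[OF *(1)] by simp
    then show False using u x by simp
  qed
  then show thesis using that r0 below above by blast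
qed

lemma virtual_valuation_measurable [measurable]: "virtual_valuation f \<in> borel_measurable borel"
  unfolding virtual_valuation_def[abs_def] by measurable

text \<open>Where \<open>f x > 0\<close>, \<open>f x\<close> times the virtual valuation is \<open>x * f x - (1 - F x)\<close>. Weighting by
  \<open>n * F x ^ (n - 1)\<close> and integrating over \<open>x \<ge> r\<close>, the first term is the layer-cake integral of the
  maximum and the second is the difference between \<open>1 - F x ^ n\<close> and \<open>second_tail n (F x)\<close>, so no
  integration by parts against the merely measurable \<open>f\<close> is needed.\<close>

lemma Myerson_le:
  assumes n: "n \<ge> 2" and r: "0 \<le> r" "F r \<le> 1 - exp (- 1)"
    and below: "\<And>x. 0 \<le> x \<Longrightarrow> x < r \<Longrightarrow> x * hazard x < 1"
    and above: "\<And>x. r < x \<Longrightarrow> F x < 1 \<Longrightarrow> 1 \<le> x * hazard x"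
  shows "ennreal (Myerson f n) \<le> ennreal (r * (1 - F r ^ n)) + second_tail_integral n r"
proof -
  let ?V = "valuations f n" and ?X = "order_stat n n"
  let ?w = "\<lambda>x. ennreal (real n * F x ^ (n - 1) * f x)"
  have n1: "n \<ge> 1" using n by simp
  note [measurable] = measurable_maximum[OF n1]
  define d where "d = (\<lambda>t. ennreal (real n * F t ^ (n - 1) * (1 - F t)))"
  have [measurable]: "d \<in> borel_measurable borel" unfolding d_def by measurable
  \<comment> \<open>The integral of the subtracted part of the virtual valuation. It is added to
    both sides to keep all terms nonnegative, and cancelled once it is known to be finite.\<close>
  define I where "I = (\<integral>\<^sup>+t. d t * indicator {r..} t \<partial>lborel)"
  have split: "?w x * ennreal (max 0 (virtual_valuation f x)) + d x * indicator {r..} x =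
      ?w x * (ennreal x * indicator {r..} x)" if "x \<noteq> r" "x \<noteq> 0" for x
  proof -
    consider "x < 0" | "0 < x" "x < r" | "r < x" "F x < 1" | "r < x" "F x = 1"
      using \<open>x \<noteq> r\<close> \<open>x \<noteq> 0\<close> F_le_one[of x] by linarith
    then show ?thesis
    proof cases
      case 1
      then have "x \<notin> D" using D_nonneg by auto
      then show ?thesis using 1 r f_outside by simp
    next
      case 2
      have "F x < 1"
        using F_mono[of x r] 2 r exp_gt_zero[of "-1::real"] by linarith
      then have "x * f x < 1 - F x"
        using below[of x] 2 by (simp add: hazard_def field_simps)
      then have "virtual_valuation f x \<le> 0" if "f x \<noteq> 0"
        using f_nonneg[of x] that by (simp add: virtual_valuation_def le_divide_eq)
      \<comment> \<open>If \<open>f x = 0\<close>, division by zero makes the virtual valuation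
        \<open>x\<close>, but then the weight \<open>?w x\<close> is 0.\<close>
      then show ?thesis using 2 by (cases "f x = 0") (auto simp: max_absorb1)
    next
      case 3
      then have h: "1 \<le> x * (f x / (1 - F x))"
        using above[of x] by (simp add: hazard_def)
      then have "f x \<noteq> 0" by auto
      then have fx: "0 < f x" using f_nonneg[of x] by linarith
      then have v: "0 \<le> virtual_valuation f x"
        using h 3 by (simp add: virtual_valuation_def field_simps)
      have "real n * F x ^ (n - 1) * f x * virtual_valuation f x + real n * F x ^ (n - 1) * (1 - F x) =
          real n * F x ^ (n - 1) * f x * x"
        using fx by (simp add: virtual_valuation_def field_simps)
      then show ?thesis
        using 3 r v fx F_nonneg[of x] F_le_one[of x]
        by (simp add: d_def max_absorb2 ennreal_mult'[symmetric] ennreal_plus[symmetric] del: ennreal_plus)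
    next
      case 4
      then show ?thesis using r by (simp add: d_def virtual_valuation_def max_absorb2)
    qed
  qed
  have "(\<integral>\<^sup>+v. ennreal (max 0 (virtual_valuation f (?X v))) \<partial>?V) + I =
      (\<integral>\<^sup>+x. ?w x * ennreal (max 0 (virtual_valuation f x)) + d x * indicator {r..} x \<partial>lborel)"
    unfolding I_def by (subst nn_integral_law_maximum[OF n1]; (subst nn_integral_add)?; measurable?)
  also have "\<dots> = (\<integral>\<^sup>+x. ?w x * (ennreal x * indicator {r..} x) \<partial>lborel)"
  proof (rule nn_integral_cong_AE)
    show "AE x in lborel. ?w x * ennreal (max 0 (virtual_valuation f x)) + d x * indicator {r..} x =
        ?w x * (ennreal x * indicator {r..} x)"
      using AE_lborel_singleton[of r] AE_lborel_singleton[of 0] by eventually_elim (rule split)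
  qed
  also have "\<dots> = (\<integral>\<^sup>+v. ennreal (?X v) * indicator {r..} (?X v) \<partial>?V)"
    by (rule nn_integral_law_maximum[OF n1, symmetric]) measurable
  also have "\<dots> = ennreal (r * (1 - F r ^ n)) + (\<integral>\<^sup>+t. ennreal (1 - F t ^ n) * indicator {r..} t \<partial>lborel)"
    by (rule maximum_tail[OF n1 r(1)])
  also have "(\<integral>\<^sup>+t. ennreal (1 - F t ^ n) * indicator {r..} t \<partial>lborel) =
      (\<integral>\<^sup>+t. ennreal (second_tail n (F t)) * indicator {r..} t + d t * indicator {r..} t \<partial>lborel)"
    using second_tail_nonneg[OF F_nonneg F_le_one n] F_nonneg F_le_one
    by (intro nn_integral_cong)
      (auto simp: d_def second_tail_def ennreal_plus[symmetric] simp del: ennreal_plus split: split_indicator)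
  also have "\<dots> = second_tail_integral n r + I"
    unfolding I_def second_tail_integral_def by (rule nn_integral_add) measurable
  finally have "(\<integral>\<^sup>+v. ennreal (max 0 (virtual_valuation f (?X v))) \<partial>?V) + I =
      (ennreal (r * (1 - F r ^ n)) + second_tail_integral n r) + I"
    by (simp add: add.assoc)
  moreover have "I < \<infinity>"
  proof -
    have "I \<le> (\<integral>\<^sup>+t. ennreal (real n) * (ennreal (1 - F t) * indicator {0..} t) \<partial>lborel)"
      unfolding I_def
    proof (rule nn_integral_mono)
      fix t
      have "real n * F t ^ (n - 1) * (1 - F t) \<le> real n * (1 - F t)"
        using F_nonneg[of t] F_le_one[of t]
        by (intro mult_right_mono) (auto intro!: mult_left_le power_le_one)
      then show "d t * indicator {r..} t \<le> ennreal (real n) * (ennreal (1 - F t) * indicator {0..} t)"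
        using r F_le_one[of t]
        by (auto simp: d_def ennreal_mult'[symmetric] split: split_indicator intro!: ennreal_leI)
    qed
    also have "\<dots> = ennreal (real n) * (\<integral>\<^sup>+t. ennreal (1 - F t) * indicator {0..} t \<partial>lborel)"
      by (rule nn_integral_cmult) measurable
    also have "\<dots> < \<infinity>"
      using survival_integrable by (simp add: ennreal_mult_less_top)
    finally show ?thesis .
  qed
  ultimately have "(\<integral>\<^sup>+v. ennreal (max 0 (virtual_valuation f (?X v))) \<partial>?V) =
      ennreal (r * (1 - F r ^ n)) + second_tail_integral n r"
    using ennreal_add_left_cancel[of I] by (auto simp: add.commute)
  \<comment> \<open>Only an upper bound is claimed: an infinite integral would be turned into 0 by
    \<open>enn2real\<close>.\<close>
  moreover have "Myerson f n = enn2real (\<integral>\<^sup>+v. ennreal (max 0 (virtual_valuation f (?X v))) \<partial>?V)"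
    unfolding Myerson_def by (rule integral_eq_nn_integral) auto
  ultimately show ?thesis
    by (metis ennreal_enn2real_if zero_le order_refl)
qed

text \<open>The chord bound puts \<open>F\<close> on \<open>[0, r]\<close> below the exponential cdf
  of rate \<open>l / r\<close>, whose integral is \<open>r / l * second_tail_prim n (F r)\<close>.
  The claim then reduces to \<open>ratio_bound_ge\<close>.\<close>

lemma second_tail_integral_reserve:
  assumes n: "n \<ge> 2" and r: "0 \<le> r" "F r \<le> 1 - exp (- 1)"
  shows "ennreal (r * (1 - F r ^ n)) \<le>
    ennreal (ratio_bound n) * (\<integral>\<^sup>+t. ennreal (second_tail n (F t)) * indicator {0..r} t \<partial>lborel)"
proof -
  define l where "l = cum_hazard r"
  have Fr: "F r < 1" using r exp_gt_zero[of "-1::real"] by linarith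
  have u: "F r = 1 - exp (- l)" using F_eq_cum_hazard[OF Fr] by (simp add: l_def)
  have l: "0 \<le> l" "l \<le> 1" using cum_hazard_nonneg[OF Fr] u r by (auto simp: l_def)
  note B = ratio_bound_ge_one[OF n]
  show ?thesis
  proof (cases "r = 0 \<or> l = 0")
    \<comment> \<open>The rate \<open>l / r\<close> is degenerate here, but \<open>F\<close>
      vanishes on \<open>[0, r]\<close>, so the integrand is 1 there.\<close>
    case True
    then have "F r = 0" using u F_zero by auto
    have "ennreal (r * (1 - F r ^ n)) = (\<integral>\<^sup>+t. indicator {0..r} t \<partial>lborel)"
      using r n \<open>F r = 0\<close> by (simp add: power_0_left)
    also have "\<dots> \<le> (\<integral>\<^sup>+t. ennreal (second_tail n (F t)) * indicator {0..r} t \<partial>lborel)"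
    proof (intro nn_integral_mono)
      fix t
      have "F t = 0" if "t \<le> r" using F_mono[OF that] F_nonneg[of t] \<open>F r = 0\<close> by simp
      then show "indicator {0..r} t \<le> ennreal (second_tail n (F t)) * indicator {0..r} t"
        using n by (auto simp: second_tail_zero split: split_indicator)
    qed
    also have "\<dots> \<le> ennreal (ratio_bound n) * \<dots>"
      using mult_right_mono[OF ennreal_leI[OF B]] by simp
    finally show ?thesis .
  next
    case False
    then have rl: "0 < r" "0 < l" using r l by auto
    define a where "a = l / r"
    have a: "0 < a" using rl by (simp add: a_def)
    let ?E = "\<lambda>t. 1 - exp (- (a * (t - 0)))"
    have "second_tail_prim n (?E r) / a - second_tail_prim n (?E 0) / a = r / l * second_tail_prim n (F r)"
      using rl n by (simp add: a_def u second_tail_prim_def sum.neutral power_0_left)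
    moreover have "(\<integral>\<^sup>+t. ennreal (second_tail n (?E t)) * indicator {0..r} t \<partial>lborel) =
        ennreal (second_tail_prim n (?E r) / a - second_tail_prim n (?E 0) / a)"
    proof (rule nn_integral_FTC_Icc[where F = "\<lambda>t. second_tail_prim n (?E t) / a"])
      show "((\<lambda>t. second_tail_prim n (?E t) / a) has_real_derivative second_tail n (?E t)) (at t)" for t
        by (rule DERIV_second_tail_prim_exp[OF a])
      show "0 \<le> second_tail n (?E t)" if "t \<in> {0..r}" for t
        using that a n by (intro second_tail_nonneg) auto
      show "(\<lambda>t. second_tail n (?E t)) \<in> borel_measurable borel"
        by measurable
    qed (use r in simp)
    ultimately have int: "(\<integral>\<^sup>+t. ennreal (second_tail n (?E t)) * indicator {0..r} t \<partial>lborel) =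
        ennreal (r / l * second_tail_prim n (F r))" by simp
    have "l * (1 - F r ^ n) \<le> ratio_bound n * second_tail_prim n (F r)"
      using ratio_bound_ge[OF n l] by (simp add: u)
    then have "r / l * (l * (1 - F r ^ n)) \<le> r / l * (ratio_bound n * second_tail_prim n (F r))"
      using rl by (intro mult_left_mono) auto
    then have "ennreal (r * (1 - F r ^ n)) \<le> ennreal (ratio_bound n * (r / l * second_tail_prim n (F r)))"
      using rl by (intro ennreal_leI) (simp add: mult_ac)
    also have "\<dots> = ennreal (ratio_bound n) * (\<integral>\<^sup>+t. ennreal (second_tail n (?E t)) * indicator {0..r} t \<partial>lborel)"
      using B unfolding int by (intro ennreal_mult') simp
    also have "\<dots> \<le> ennreal (ratio_bound n) * (\<integral>\<^sup>+t. ennreal (second_tail n (F t)) * indicator {0..r} t \<partial>lborel)"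
    proof (intro mult_left_mono nn_integral_mono)
      fix t
      have "second_tail n (?E t) \<le> second_tail n (F t)" if t: "0 \<le> t" "t \<le> r"
      proof -
        have "F t < 1" using F_mono[OF t(2)] Fr by simp
        have "cum_hazard t \<le> a * (t - 0)"
          using cum_hazard_star[OF t Fr] rl by (simp add: a_def l_def field_simps)
        then have "F t \<le> ?E t"
          using F_eq_cum_hazard[OF \<open>F t < 1\<close>] by simp
        then show ?thesis
          by (intro second_tail_antimono F_nonneg n) auto
      qed
      then show "ennreal (second_tail n (?E t)) * indicator {0..r} t \<le> ennreal (second_tail n (F t)) * indicator {0..r} t"
        by (auto split: split_indicator intro: ennreal_leI)
    qed simp
    finally show ?thesis .
  qed
qed

text \<open>The integral beyond \<open>r\<close> occurs on both sides and is absorbed by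
  \<open>ratio_bound n \<ge> 1\<close>; only the part on \<open>[0, r]\<close> needs the full
  factor.\<close>

lemma Myerson_le_second_highest:
  assumes n: "n \<ge> 2"
  shows "ennreal (Myerson f n) \<le> ennreal (ratio_bound n) * second_tail_integral n 0"
proof -
  obtain r where r: "0 \<le> r" "F r \<le> 1 - exp (- 1)"
    "\<And>x. 0 \<le> x \<Longrightarrow> x < r \<Longrightarrow> x * hazard x < 1"
    "\<And>x. r < x \<Longrightarrow> F x < 1 \<Longrightarrow> 1 \<le> x * hazard x"
    using reserve_exists by metis
  define J where "J = (\<integral>\<^sup>+t. ennreal (second_tail n (F t)) * indicator {0..r} t \<partial>lborel)"
  have "ennreal (Myerson f n) \<le> ennreal (r * (1 - F r ^ n)) + second_tail_integral n r"
    by (rule Myerson_le[OF n r])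
  also have "\<dots> \<le> ennreal (ratio_bound n) * J + ennreal (ratio_bound n) * second_tail_integral n r"
    using second_tail_integral_reserve[OF n r(1,2)]
      mult_right_mono[OF ennreal_leI[OF ratio_bound_ge_one[OF n]], of "second_tail_integral n r"]
    unfolding J_def by (intro add_mono) simp_all
  also have "\<dots> = ennreal (ratio_bound n) * (J + second_tail_integral n r)"
    by (simp add: distrib_left)
  also have "J + second_tail_integral n r = second_tail_integral n 0"
    unfolding J_def second_tail_integral_def
    using r AE_lborel_singleton[of r]
    by (subst nn_integral_add[symmetric]) (auto intro!: nn_integral_cong_AE split: split_indicator)
  finally show ?thesis .
qed

end

section \<open>The revenue guarantee of the anonymous price\<close>

theorem theorem4p6:
  fixes f :: "real \<Rightarrow> real" and D :: "real set" and n :: nat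
  assumes "pdf_on f D"
    and "MHR f D"
    and "n \<ge> 2"
  shows "(\<exists>!c. is_arg_max (g n) (\<lambda>c. c \<in> {0..1}) c) \<and>
    0 < Price f n (c_opt n * expected_order_stat f (n - 1) n) \<and>
    Myerson f n / Price f n (c_opt n * expected_order_stat f (n - 1) n)
      \<le> 1 / (SUP c\<in>{0..1}. g n c) *
         (1 + 1 / exp 1 * ((real n - 1) / (real n - harm n)) * ((exp 1 - 1) / exp 1) ^ (n - 2))"
proof -
  interpret mhr_density f D
    using assms by unfold_locales
  note n = \<open>n \<ge> 2\<close>
  define \<mu> where "\<mu> = expected_order_stat f (n - 1) n"
  define c where "c = c_opt n"
  have c: "0 < c" "c \<le> 1" "0 < g n c" "g n c = (SUP c\<in>{0..1}. g n c)"
    using c_opt[OF n] by (auto simp: c_def)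
  obtain m where m: "0 < m" "F m < 1" "cum_hazard m = harm n - 1" "0 < hazard m" "harm n - 1 \<le> hazard m * m"
    using cum_hazard_attains[of "harm n - 1"] harm_bounds(1)[OF n] by auto
  have le_m: "second_tail_integral n 0 \<le> ennreal m"
    using second_tail_integral_le[OF n m(2,4,3,1,5)] .
  then have fin: "second_tail_integral n 0 < \<infinity>"
    by (rule le_less_trans) simp
  note \<mu> = expected_second_highest[OF n fin, folded \<mu>_def]
  have "\<mu> \<le> m"
    using le_m m(1) unfolding \<mu>(1)[symmetric] by simp
  \<comment> \<open>On \<open>[0, m]\<close> the integrand is at least
    \<open>second_tail n (F m)\<close>, positive because \<open>F m < 1\<close>.\<close>
  have "0 < \<mu>"
  proof -
    have "ennreal (second_tail n (F m) * m) = (\<integral>\<^sup>+t. ennreal (second_tail n (F m)) * indicator {0..m} t \<partial>lborel)"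
      using m(1) second_tail_nonneg[OF F_nonneg F_le_one n] by (simp add: nn_integral_cmult ennreal_mult')
    also have "\<dots> \<le> second_tail_integral n 0"
      unfolding second_tail_integral_def
      by (intro nn_integral_mono)
        (auto split: split_indicator intro!: ennreal_leI second_tail_antimono F_nonneg F_mono F_le_one n)
    finally have "second_tail n (F m) * m \<le> \<mu>"
      unfolding \<mu>(1)[symmetric] using \<mu>(2) by simp
    moreover have "0 < second_tail n (F m) * m"
      using second_tail_pos[OF F_nonneg m(2) n] m(1) by simp
    ultimately show ?thesis by linarith
  qed
  have "Myerson f n \<le> ratio_bound n * \<mu>"
    using Myerson_le_second_highest[OF n] \<mu>(2) ratio_bound_ge_one[OF n] unfolding \<mu>(1)[symmetric]
    by (simp add: ennreal_mult'[symmetric])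
  have price: "\<mu> * g n c \<le> Price f n (c * \<mu>)"
  proof -
    \<comment> \<open>The chord bound is applied at \<open>c * m\<close>, since
      \<open>cum_hazard\<close> is known exactly at \<open>m\<close>; monotonicity of
      \<open>F\<close> carries it to the smaller price \<open>c * \<mu>\<close>.\<close>
    have cm: "c * \<mu> \<le> c * m" "c * m \<le> m" "0 \<le> c * m"
      using c m(1) \<open>\<mu> \<le> m\<close> by auto
    have Fcm: "F (c * m) < 1"
      using F_mono[OF cm(2)] m(2) by simp
    have "cum_hazard (c * m) * m \<le> c * m * (harm n - 1)"
      using cum_hazard_star[OF cm(3,2) m(2)] m(3) by simp
    then have "cum_hazard (c * m) \<le> c * (harm n - 1)"
      using m(1) by (simp add: mult.commute mult.left_commute)
    then have "F (c * m) \<le> 1 - exp (- c * (harm n - 1))"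
      using F_eq_cum_hazard[OF Fcm] by simp
    then have "F (c * \<mu>) \<le> 1 - exp (- c * (harm n - 1))"
      using F_mono[OF cm(1)] by simp
    then have "F (c * \<mu>) ^ n \<le> (1 - exp (- c * (harm n - 1))) ^ n"
      by (intro power_mono F_nonneg)
    then show ?thesis
      using c(1) \<open>0 < \<mu>\<close> by (simp add: Price_def g_def mult.left_commute mult.assoc)
  qed
  have pos: "0 < \<mu> * g n c"
    using c \<open>0 < \<mu>\<close> by simp
  then have "0 < Price f n (c * \<mu>)"
    using price by linarith
  have "Myerson f n / Price f n (c * \<mu>) \<le> ratio_bound n * \<mu> / (\<mu> * g n c)"
    using \<open>Myerson f n \<le> ratio_bound n * \<mu>\<close> \<open>0 < \<mu>\<close> ratio_bound_ge_one[OF n] pos price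
    by (intro frac_le) auto
  also have "\<dots> = 1 / g n c * ratio_bound n"
    using \<open>0 < \<mu>\<close> by simp
  finally have "Myerson f n / Price f n (c * \<mu>) \<le> 1 / (SUP c\<in>{0..1}. g n c) * ratio_bound n"
    by (simp only: c(4))
  with \<open>0 < Price f n (c * \<mu>)\<close> show ?thesis
    using unique_maximizer_g[OF n] unfolding ratio_bound_def c_def \<mu>_def by blast
qed

end
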